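(* Let $\ell\in\mathbb{R}\setminus\{0\}$, $\xi\in\mathbb{R}$ and $\kappa>1$. Then for almost all $Q\in\mathcal{Q}(2,1;\ell)$ there exists $\varepsilon_0=\varepsilon_0(Q,\xi,\kappa)>0$ such that for every $\varepsilon\in(0,\varepsilon_0)$ there exists $x\in\mathbb{Z}^3\setminus\{0\}$ satisfying $$|Q(x)-\xi|<\varepsilon\quad\text{and}\quad \|x\|<\varepsilon^{-\kappa}.$$
   Context: $\|\cdot\|$ denotes the maximum norm on $\mathbb{R}^3$. $\mathcal{Q}(p,q;\ell)$ denotes the set of real non-degenerate quadratic forms $Q(x)=\sum_{i,j=1}^n a_{ij}x_ix_j$ (with $a_{ij}=a_{ji}$) in $n=p+q$ variables, of signature $(p,q)$ and discriminant $\det(a_{ij})=\ell$. The group $\mathrm{SL}_3(\mathbb{R})$ acts transitively on $\mathcal{Q}(2,1;\ell)$ (when it is non-empty) by $Q\mapsto Q\circ g^{-1}$, and "almost all" refers to the resulting $\mathrm{SL}_3(\mathbb{R})$-invariant measure class; equivalently, for a fixed $Q_0\in\mathcal{Q}(2,1;\ell)$ the assertion holds for $Q=Q_0\circ g^{-1}$ for Haar-almost all $g\in\mathrm{SL}_3(\mathbb{R})$. *)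

theory Defs
  imports "HOL-Analysis.Analysis"
begin

definition quadratic_form :: "real^'n^'n \<Rightarrow> real^'n \<Rightarrow> real" where
  "quadratic_form A x = (\<Sum>i\<in>UNIV. \<Sum>j\<in>UNIV. A $ i $ j * x $ i * x $ j)"

text \<open>
  Signature \<open>(p, q)\<close> with \<open>p + q = CARD('n)\<close>: some invertible linear change of variables
  turns \<open>Q\<close> into a sum of \<open>p\<close> squares minus a sum of the \<open>q\<close> remaining squares, as in
  Sylvester's law of inertia. All variables occur, so this includes non-degeneracy.
\<close>

definition has_signature :: "(real^'n \<Rightarrow> real) \<Rightarrow> nat \<Rightarrow> nat \<Rightarrow> bool" where
  "has_signature Q p q \<longleftrightarrow>
    (\<exists>(S :: 'n set) (B :: real^'n^'n). card S = p \<and> card (- S) = q \<and> invertible B \<and>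
      (\<forall>x. Q (B *v x) = (\<Sum>i\<in>S. (x $ i)\<^sup>2) - (\<Sum>i\<in>- S. (x $ i)\<^sup>2)))"

definition quadratic_forms :: "nat \<Rightarrow> nat \<Rightarrow> real \<Rightarrow> (real^'n \<Rightarrow> real) set" where
  "quadratic_forms p q l =
    {quadratic_form A | A. transpose A = A \<and> det A = l \<and> has_signature (quadratic_form A) p q}"

definition SL :: "(real^'n^'n) set" where
  "SL = {g. det g = 1}"

text \<open>
  Haar measures on \<open>SL\<close>. Since \<open>SL\<close> is closed in the space of matrices, it is locally compact
  and second countable, so a Borel measure on it that is finite on compact sets is
  automatically regular. The group is unimodular, so left and right Haar measures agree.
\<close>

definition haar_measure_SL :: "(real^'n^'n) measure \<Rightarrow> bool" where
  "haar_measure_SL \<mu> \<longleftrightarrow>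
    sets \<mu> = sets (restrict_space borel SL) \<and>
    (\<forall>h\<in>SL. \<forall>E\<in>sets \<mu>. emeasure \<mu> ((\<lambda>g. h ** g) ` E) = emeasure \<mu> E) \<and>
    (\<forall>K. compact K \<and> K \<subseteq> SL \<longrightarrow> emeasure \<mu> K < \<infinity>) \<and>
    emeasure \<mu> SL \<noteq> 0"

text \<open>
  \<open>P\<close> holds for almost all forms with respect to the \<open>SL\<close>-invariant measure class. The action is
  transitive and Haar measure is unique up to scaling, so neither the base point \<open>Q0\<close> nor
  the choice of \<open>\<mu>\<close> matters.
\<close>

definition almost_all_forms :: "nat \<Rightarrow> nat \<Rightarrow> real \<Rightarrow> ((real^'n \<Rightarrow> real) \<Rightarrow> bool) \<Rightarrow> bool" where
  "almost_all_forms p q l P \<longleftrightarrow>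
    (\<forall>Q0\<in>quadratic_forms p q l. \<forall>\<mu>. haar_measure_SL \<mu> \<longrightarrow>
      (AE g in \<mu>. P (\<lambda>x. Q0 (matrix_inv g *v x))))"

end

theory Submission
  imports Defs "HOL-Probability.Probability" "HOL-Real_Asymp.Real_Asymp"
begin

text \<open>
  Let \<open>h\<close> be the shear \<open>x\<^sub>3 \<mapsto> x\<^sub>3 - \<theta>\<^sub>1 x\<^sub>1 - \<theta>\<^sub>2 x\<^sub>2\<close>. By left invariance of Haar measure and Fubini it
  suffices that, for a fixed form \<open>Q\<close>, the form \<open>Q \<circ> h\<inverse>\<close> is good for almost all \<open>\<theta>\<close> in the unit
  square. For integer \<open>u = (x\<^sub>1, x\<^sub>2)\<close> of size about \<open>N\<close> in a suitable sector, the solutions \<open>z\<close> of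
  \<open>\<bar>Q(u, z) - \<xi>\<bar> < \<epsilon>\<close> contain an interval of length about \<open>\<epsilon> / N\<close>, and the event that some integer
  translate of \<open>\<theta> \<bullet> u\<close> falls into it has this length as its probability. For linearly independent
  \<open>u\<close> these events are exactly independent in pairs, since \<open>\<theta> \<mapsto> (\<theta> \<bullet> u, \<theta> \<bullet> u')\<close> preserves the
  measure of the torus. There are about \<open>N\<^sup>2\<close> pairwise independent \<open>u\<close>, so by Chebyshev's inequality
  all the events fail with probability at most a constant times \<open>1 / (N \<epsilon>)\<close>. With \<open>\<epsilon> = 2\<^sup>-\<^sup>k\<close> and
  \<open>N\<close> about \<open>\<epsilon> powr (- \<kappa>)\<close> this is summable over \<open>k\<close>, and Borel-Cantelli applies.
\<close>

section \<open>Pairwise independent linear forms on the torus\<close>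

text \<open>Lebesgue measure of the circle, kept on the whole real line: functions on the circle are
  1-periodic functions on \<open>real\<close>, so no quotient is formed.\<close>

definition unif :: "real measure" where
  "unif = uniform_measure lborel {0..<1}"

lemma sets_unif [measurable_cong, simp]: "sets unif = sets borel"
  by (simp add: unif_def)

lemma space_unif [simp]: "space unif = UNIV"
  by (simp add: unif_def)

lemma prob_space_unif: "prob_space unif"
  unfolding unif_def by (rule prob_space_uniform_measure) auto

lemma AE_unif: "AE t in unif. t \<in> {0..<1}"
  unfolding unif_def by (rule AE_uniform_measureI) auto

lemma nn_integral_unif:
  assumes [measurable]: "f \<in> borel_measurable borel"
  shows "(\<integral>\<^sup>+ t. f t \<partial>unif) = (\<integral>\<^sup>+ t\<in>{0..<1}. f t \<partial>lborel)"
  unfolding unif_def by (subst nn_integral_uniform_measure) (auto simp: divide_ennreal_def)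

lemma nn_integral_shift:
  fixes f :: "real \<Rightarrow> ennreal"
  assumes [measurable]: "f \<in> borel_measurable borel"
  shows "(\<integral>\<^sup>+ t. f (t + a) \<partial>lborel) = (\<integral>\<^sup>+ t. f t \<partial>lborel)"
  using nn_integral_real_affine[OF assms, of 1 a] by (simp add: add.commute)

text \<open>The window [a, 1 + a) is cut at 1, and periodicity moves the overhang [1, 1 + a) back to
  [0, a).\<close>

lemma nn_integral_unif_shift_frac:
  fixes f :: "real \<Rightarrow> ennreal"
  assumes [measurable]: "f \<in> borel_measurable borel"
    and per: "\<And>t. f (t + 1) = f t" and a: "0 \<le> a" "a < 1"
  shows "(\<integral>\<^sup>+ t. f (t + a) \<partial>unif) = (\<integral>\<^sup>+ t. f t \<partial>unif)"
proof -
  have "(\<integral>\<^sup>+ t. f (t + a) \<partial>unif) = (\<integral>\<^sup>+ t\<in>{0..<1}. f (t + a) \<partial>lborel)"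
    by (simp add: nn_integral_unif)
  also have "\<dots> = (\<integral>\<^sup>+ t. (\<lambda>s. f s * indicator {a..<1+a} s) (t + a) \<partial>lborel)"
    by (intro nn_integral_cong) (auto split: split_indicator)
  also have "\<dots> = (\<integral>\<^sup>+ s. f s * indicator {a..<1+a} s \<partial>lborel)"
    by (rule nn_integral_shift) measurable
  also have "\<dots> = (\<integral>\<^sup>+ s. f s * indicator {a..<1} s + f s * indicator {1..<1+a} s \<partial>lborel)"
    using a by (intro nn_integral_cong) (auto split: split_indicator)
  also have "\<dots> = (\<integral>\<^sup>+ s. f s * indicator {a..<1} s \<partial>lborel) + (\<integral>\<^sup>+ s. f s * indicator {1..<1+a} s \<partial>lborel)"
    by (rule nn_integral_add) auto
  also have "(\<integral>\<^sup>+ s. f s * indicator {1..<1+a} s \<partial>lborel)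
     = (\<integral>\<^sup>+ s. (\<lambda>s. f s * indicator {1..<1+a} s) (s + 1) \<partial>lborel)"
    by (rule nn_integral_shift [symmetric]) measurable
  also have "\<dots> = (\<integral>\<^sup>+ s. f s * indicator {0..<a} s \<partial>lborel)"
    by (intro nn_integral_cong) (auto simp: per split: split_indicator)
  also have "(\<integral>\<^sup>+ s. f s * indicator {a..<1} s \<partial>lborel) + (\<integral>\<^sup>+ s. f s * indicator {0..<a} s \<partial>lborel)
     = (\<integral>\<^sup>+ s. f s * indicator {a..<1} s + f s * indicator {0..<a} s \<partial>lborel)"
    by (rule nn_integral_add [symmetric]) auto
  also have "\<dots> = (\<integral>\<^sup>+ t\<in>{0..<1}. f t \<partial>lborel)"
    using a by (intro nn_integral_cong) (auto split: split_indicator)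
  finally show ?thesis by (simp add: nn_integral_unif)
qed

lemma periodic_add_int:
  fixes f :: "real \<Rightarrow> 'a"
  assumes per: "\<And>t. f (t + 1) = f t"
  shows "f (t + of_int k) = f t"
proof (induction k arbitrary: t rule: int_induct [where k = 0])
  case (step1 i)
  have "f (t + of_int (i + 1)) = f ((t + of_int i) + 1)" by (simp add: algebra_simps)
  then show ?case using step1 per by simp
next
  case (step2 i)
  have "f (t + of_int (i - 1)) = f ((t + of_int (i - 1)) + 1)" by (rule per [symmetric])
  also have "\<dots> = f (t + of_int i)" by (simp add: algebra_simps)
  finally show ?case using step2 by simp
qed simp

lemma nn_integral_unif_shift:
  fixes f :: "real \<Rightarrow> ennreal"
  assumes "f \<in> borel_measurable borel" and per: "\<And>t. f (t + 1) = f t"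
  shows "(\<integral>\<^sup>+ t. f (t + a) \<partial>unif) = (\<integral>\<^sup>+ t. f t \<partial>unif)"
proof -
  have "f (t + a) = f (t + frac a)" for t
    using periodic_add_int[of f "t + frac a" "\<lfloor>a\<rfloor>"] per by (simp add: frac_def)
  then show ?thesis
    using nn_integral_unif_shift_frac[OF assms, of "frac a"] by (simp add: frac_lt_1)
qed

text \<open>
  Both sides are averaged over a translation of the torus. Since the two linear forms are
  independent, a translation can shift their values by an arbitrary pair \<open>(s, t)\<close>.
\<close>

lemma nn_integral_unif_independent:
  fixes f g :: "real \<Rightarrow> ennreal" and p q p' q' :: int
  assumes [measurable]: "f \<in> borel_measurable borel" "g \<in> borel_measurable borel"
    and perf: "\<And>t. f (t + 1) = f t" and perg: "\<And>t. g (t + 1) = g t"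
    and det: "p * q' \<noteq> p' * q"
  shows "(\<integral>\<^sup>+ x. \<integral>\<^sup>+ y. f (p * x + q * y) * g (p' * x + q' * y) \<partial>unif \<partial>unif)
    = (\<integral>\<^sup>+ t. f t \<partial>unif) * (\<integral>\<^sup>+ t. g t \<partial>unif)" (is "?I = _")
proof -
  interpret U: prob_space unif by (rule prob_space_unif)
  interpret UU: pair_prob_space unif unif ..
  define D where "D = real_of_int (p * q' - p' * q)"
  have D: "D \<noteq> 0" unfolding D_def of_int_eq_0_iff using det by simp
  define G where "G x y = f (p * x + q * y) * g (p' * x + q' * y)" for x y :: real
  have [measurable]: "case_prod G \<in> borel_measurable (borel \<Otimes>\<^sub>M borel)"
    unfolding G_def by measurable
  have G1: "G (x + 1) y = G x y" for x y
    using periodic_add_int[of f "p * x + q * y" p] periodic_add_int[of g "p' * x + q' * y" p'] perf perg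
    by (simp add: G_def algebra_simps)
  have G2: "G x (y + 1) = G x y" for x y
    using periodic_add_int[of f "p * x + q * y" q] periodic_add_int[of g "p' * x + q' * y" q'] perf perg
    by (simp add: G_def algebra_simps)
  have I: "?I = (\<integral>\<^sup>+ x. \<integral>\<^sup>+ y. f (p * x + q * y + s) * g (p' * x + q' * y + t) \<partial>unif \<partial>unif)" (is "_ = ?J s t") for s t
  proof -
    \<comment> \<open>Cramer's rule: (a, b) is the translation of the torus that changes the two
      linear forms by s and t.\<close>
    define a where "a = (q' * s - q * t) / D"
    define b where "b = (p * t - p' * s) / D"
    have "p * (q' * s - q * t) + q * (p * t - p' * s) = D * s"
      "p' * (q' * s - q * t) + q' * (p * t - p' * s) = D * t"
      by (simp_all add: D_def algebra_simps)
    then have *: "p * a + q * b = s" "p' * a + q' * b = t"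
      using D by (simp_all add: a_def b_def add_divide_distrib[symmetric])
    have "?J s t = (\<integral>\<^sup>+ x. \<integral>\<^sup>+ y. G (x + a) (y + b) \<partial>unif \<partial>unif)"
      unfolding G_def *[symmetric] by (simp add: algebra_simps)
    also have "\<dots> = (\<integral>\<^sup>+ x. \<integral>\<^sup>+ y. G (x + a) y \<partial>unif \<partial>unif)"
      by (intro nn_integral_cong nn_integral_unif_shift G2) measurable
    also have "\<dots> = (\<integral>\<^sup>+ x. \<integral>\<^sup>+ y. G x y \<partial>unif \<partial>unif)"
      by (rule nn_integral_unif_shift[of "\<lambda>x. \<integral>\<^sup>+ y. G x y \<partial>unif"]) (simp_all add: G1)
    finally show ?thesis by (simp add: G_def)
  qed
  \<comment> \<open>As \<open>unif\<close> has mass 1, the constant \<open>?I\<close> may be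
    averaged over (s, t). Once t, and then s, is the innermost variable, each factor integrates on
    its own by \<open>nn_integral_unif_shift\<close>.\<close>
  have "?I = (\<integral>\<^sup>+ s. \<integral>\<^sup>+ t. ?I \<partial>unif \<partial>unif)"
    using U.emeasure_space_1 by simp
  also have "\<dots> = (\<integral>\<^sup>+ s. \<integral>\<^sup>+ t. ?J s t \<partial>unif \<partial>unif)"
    by (intro nn_integral_cong I)
  also have "\<dots> = (\<integral>\<^sup>+ s. \<integral>\<^sup>+ x. \<integral>\<^sup>+ t. \<integral>\<^sup>+ y. f (p * x + q * y + s) * g (p' * x + q' * y + t) \<partial>unif \<partial>unif \<partial>unif \<partial>unif)"
    by (intro nn_integral_cong UU.Fubini') measurable
  also have "\<dots> = (\<integral>\<^sup>+ s. \<integral>\<^sup>+ x. \<integral>\<^sup>+ y. \<integral>\<^sup>+ t. f (p * x + q * y + s) * g (p' * x + q' * y + t) \<partial>unif \<partial>unif \<partial>unif \<partial>unif)"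
    by (intro nn_integral_cong UU.Fubini') measurable
  also have "\<dots> = (\<integral>\<^sup>+ s. \<integral>\<^sup>+ x. \<integral>\<^sup>+ y. f (p * x + q * y + s) * (\<integral>\<^sup>+ t. g t \<partial>unif) \<partial>unif \<partial>unif \<partial>unif)"
  proof (intro nn_integral_cong)
    fix s x y :: real
    have "(\<integral>\<^sup>+ t. f (p * x + q * y + s) * g (p' * x + q' * y + t) \<partial>unif)
      = f (p * x + q * y + s) * (\<integral>\<^sup>+ t. g (t + (p' * x + q' * y)) \<partial>unif)"
      by (subst nn_integral_cmult) (auto simp: add.commute)
    then show "(\<integral>\<^sup>+ t. f (p * x + q * y + s) * g (p' * x + q' * y + t) \<partial>unif)
      = f (p * x + q * y + s) * (\<integral>\<^sup>+ t. g t \<partial>unif)"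
      by (simp add: nn_integral_unif_shift perg)
  qed
  also have "\<dots> = (\<integral>\<^sup>+ x. \<integral>\<^sup>+ s. \<integral>\<^sup>+ y. f (p * x + q * y + s) * (\<integral>\<^sup>+ t. g t \<partial>unif) \<partial>unif \<partial>unif \<partial>unif)"
    by (intro UU.Fubini') measurable
  also have "\<dots> = (\<integral>\<^sup>+ x. \<integral>\<^sup>+ y. \<integral>\<^sup>+ s. f (p * x + q * y + s) * (\<integral>\<^sup>+ t. g t \<partial>unif) \<partial>unif \<partial>unif \<partial>unif)"
    by (intro nn_integral_cong UU.Fubini') measurable
  also have "\<dots> = (\<integral>\<^sup>+ x. \<integral>\<^sup>+ y. (\<integral>\<^sup>+ t. f t \<partial>unif) * (\<integral>\<^sup>+ t. g t \<partial>unif) \<partial>unif \<partial>unif)"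
  proof (intro nn_integral_cong)
    fix x y :: real
    have "(\<integral>\<^sup>+ s. f (p * x + q * y + s) * (\<integral>\<^sup>+ t. g t \<partial>unif) \<partial>unif)
      = (\<integral>\<^sup>+ s. f (s + (p * x + q * y)) \<partial>unif) * (\<integral>\<^sup>+ t. g t \<partial>unif)"
      by (subst nn_integral_multc) (auto simp: add.commute)
    then show "(\<integral>\<^sup>+ s. f (p * x + q * y + s) * (\<integral>\<^sup>+ t. g t \<partial>unif) \<partial>unif)
      = (\<integral>\<^sup>+ t. f t \<partial>unif) * (\<integral>\<^sup>+ t. g t \<partial>unif)"
      by (simp add: nn_integral_unif_shift perf)
  qed
  finally show ?thesis
    using U.emeasure_space_1 by simp
qed

text \<open>Translation invariance reduces to c = 0, where the set meets [0, 1) in [0, r] because r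
  < 1.\<close>

lemma emeasure_unif_frac_le:
  fixes c r :: real
  assumes "0 \<le> r" "r < 1"
  shows "emeasure unif {t. frac (t - c) \<le> r} = ennreal r"
proof -
  have [measurable]: "{t::real. frac t \<le> r} \<in> sets borel" "{t::real. frac (t - c) \<le> r} \<in> sets borel"
    by (simp_all add: frac_def)
  have "emeasure unif {t. frac (t - c) \<le> r} = (\<integral>\<^sup>+ t. indicator {t. frac (t - c) \<le> r} t \<partial>unif)"
    by simp
  also have "(\<integral>\<^sup>+ t. indicator {t. frac (t - c) \<le> r} t \<partial>unif)
     = (\<integral>\<^sup>+ t. (indicator {t. frac t \<le> r} (t + (- c)) :: ennreal) \<partial>unif)"
    by (intro nn_integral_cong) (auto split: split_indicator)
  also have "\<dots> = (\<integral>\<^sup>+ t. indicator {t. frac t \<le> r} t \<partial>unif)"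
    by (rule nn_integral_unif_shift) (auto simp: frac_1_eq split: split_indicator)
  also have "\<dots> = (\<integral>\<^sup>+ t. indicator {0..r} t \<partial>lborel)"
    unfolding nn_integral_unif[OF borel_measurable_indicator[OF \<open>{t::real. frac t \<le> r} \<in> sets borel\<close>]]
    using assms by (intro nn_integral_cong) (auto simp: frac_eq[THEN iffD2] split: split_indicator)
  finally show ?thesis using assms by simp
qed

section \<open>A second moment bound\<close>

text \<open>Chebyshev's inequality for the number of events that occur. Pairwise independence kills
  the covariances, so the variance is at most the mean \<open>card I * p\<close>; if no event
  occurs, the deviation is the whole mean.\<close>

lemma (in prob_space) prob_none_le:
  fixes p :: real
  assumes fin: "finite I" and A [measurable]: "\<And>i. i \<in> I \<Longrightarrow> A i \<in> events"
    and p: "\<And>i. i \<in> I \<Longrightarrow> prob (A i) = p"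
    and pair: "\<And>i j. i \<in> I \<Longrightarrow> j \<in> I \<Longrightarrow> i \<noteq> j \<Longrightarrow> prob (A i \<inter> A j) = p\<^sup>2"
    and pos: "p > 0" "I \<noteq> {}"
  shows "prob (space M - (\<Union>i\<in>I. A i)) \<le> 1 / (card I * p)"
proof -
  define X where "X \<omega> = (\<Sum>i\<in>I. indicator (A i) \<omega> - p)" for \<omega>
  define c where "c = real (card I)"
  have c: "c > 0" using fin pos by (simp add: c_def card_gt_0_iff)
  have int: "integrable M (\<lambda>\<omega>. (indicator (A i) \<omega> - p) * (indicator (A j) \<omega> - p))"
    if "i \<in> I" "j \<in> I" for i j
  proof (rule integrable_const_bound)
    have "\<bar>indicator B \<omega> - p\<bar> \<le> 1 + \<bar>p\<bar>" for B \<omega>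
      by (auto simp: indicator_def)
    then show "AE \<omega> in M. norm ((indicator (A i) \<omega> - p) * (indicator (A j) \<omega> - p)) \<le> (1 + \<bar>p\<bar>) * (1 + \<bar>p\<bar>)"
      by (intro AE_I2) (auto simp: abs_mult intro!: mult_mono)
  qed (use that in measurable)
  have cov: "expectation (\<lambda>\<omega>. (indicator (A i) \<omega> - p) * (indicator (A j) \<omega> - p)) = (if i = j then p - p\<^sup>2 else 0)"
    if ij: "i \<in> I" "j \<in> I" for i j
  proof -
    have "(\<lambda>\<omega>. (indicator (A i) \<omega> - p) * (indicator (A j) \<omega> - p))
      = (\<lambda>\<omega>. indicator (A i \<inter> A j) \<omega> - p * indicator (A i) \<omega> - p * indicator (A j) \<omega> + p\<^sup>2)"
      by (auto simp: fun_eq_iff indicator_def power2_eq_square algebra_simps)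
    moreover have "integrable M (indicator B :: _ \<Rightarrow> real)" if "B \<in> events" for B
      using that by (simp add: integrable_real_indicator emeasure_eq_measure)
    ultimately have "expectation (\<lambda>\<omega>. (indicator (A i) \<omega> - p) * (indicator (A j) \<omega> - p))
      = prob (A i \<inter> A j) - p * prob (A i) - p * prob (A j) + p\<^sup>2"
      using ij by (simp add: prob_space measure_def[symmetric])
    then show ?thesis using p pair ij by (simp add: power2_eq_square)
  qed
  have X2: "(X \<omega>)\<^sup>2 = (\<Sum>i\<in>I. \<Sum>j\<in>I. (indicator (A i) \<omega> - p) * (indicator (A j) \<omega> - p))" for \<omega>
    unfolding X_def power2_eq_square by (rule sum_product)
  have intX: "integrable M (\<lambda>\<omega>. (X \<omega>)\<^sup>2)"
    unfolding X2 by (intro Bochner_Integration.integrable_sum int)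
  have "expectation (\<lambda>\<omega>. (X \<omega>)\<^sup>2) = (\<Sum>i\<in>I. \<Sum>j\<in>I. if i = j then p - p\<^sup>2 else 0)"
    unfolding X2 by (simp add: Bochner_Integration.integral_sum int cov)
  also have "\<dots> = c * (p - p\<^sup>2)"
    using fin by (simp add: c_def)
  also have "\<dots> \<le> c * p"
    using c by (intro mult_left_mono) auto
  finally have E: "expectation (\<lambda>\<omega>. (X \<omega>)\<^sup>2) \<le> c * p" .
  let ?N = "space M - (\<Union>i\<in>I. A i)"
  have [measurable]: "?N \<in> events" using fin A by (intro sets.Diff sets.top sets.finite_UN) auto
  have "(c * p)\<^sup>2 * prob ?N = expectation (\<lambda>\<omega>. (c * p)\<^sup>2 * indicator ?N \<omega>)"
    by simp
  also have "\<dots> \<le> expectation (\<lambda>\<omega>. (X \<omega>)\<^sup>2)"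
  proof (rule integral_mono[OF _ intX])
    fix \<omega> assume "\<omega> \<in> space M"
    show "(c * p)\<^sup>2 * indicator ?N \<omega> \<le> (X \<omega>)\<^sup>2"
    proof (cases "\<omega> \<in> ?N")
      case True
      then have "X \<omega> = - (c * p)" by (auto simp: X_def c_def indicator_def)
      then show ?thesis by (simp add: indicator_def)
    qed auto
  qed (simp add: integrable_real_indicator emeasure_eq_measure)
  finally have "(c * p)\<^sup>2 * prob ?N \<le> c * p" using E by simp
  then have "(c * p) * ((c * p) * prob ?N) \<le> (c * p) * 1"
    by (simp add: power2_eq_square mult.assoc)
  then have "(c * p) * prob ?N \<le> 1"
    using c pos by (subst (asm) mult_le_cancel_left_pos) auto
  then show ?thesis
    using c pos by (simp add: c_def[symmetric] field_simps)
qed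

section \<open>Coprime pairs\<close>

text \<open>A bound below 1 leaves a positive proportion of coprime pairs in a union bound over
  common divisors.\<close>

lemma sum_inverse_squares_le:
  "(\<Sum>d = 2..M. 1 / (real d)\<^sup>2) \<le> 3 / 4"
proof -
  \<comment> \<open>The extra term makes the induction telescope, by 1/(n+1)^2 \<le> 1/n - 1/(n+1);
    equality holds at M = 2.\<close>
  have "(\<Sum>d = 2..M. 1 / (real d)\<^sup>2) \<le> 3 / 4 - 1 / real M" if "M \<ge> 2"
    using that
  proof (induction M rule: dec_induct)
    case (step n)
    have "1 / (real (Suc n))\<^sup>2 \<le> 1 / (real n * real (Suc n))"
      using step unfolding power2_eq_square by (intro divide_left_mono mult_right_mono) auto
    also have "\<dots> = 1 / real n - 1 / real (Suc n)"
      using step by (simp add: field_simps)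
    finally have "1 / (real (Suc n))\<^sup>2 \<le> 1 / real n - 1 / real (Suc n)" .
    then show ?case using step by simp
  qed (simp)
  moreover have "(\<Sum>d = 2..M. 1 / (real d)\<^sup>2) = 0" if "\<not> M \<ge> 2"
    using that by simp
  moreover have "1 / real M \<ge> 0" by simp
  ultimately show ?thesis by linarith
qed

lemma card_multiples:
  assumes "d > 0"
  shows "real (card {x \<in> {1..N}. d dvd x}) \<le> real N / real d"
proof -
  have "{x \<in> {1..N}. d dvd x} = (\<lambda>k. d * k) ` {1..N div d}"
    using assms by (auto simp: dvd_def less_eq_div_iff_mult_less_eq mult.commute Suc_le_eq image_iff)
  then have "card {x \<in> {1..N}. d dvd x} \<le> N div d"
    by (metis card_atLeastAtMost card_image_le diff_Suc_1 finite_atLeastAtMost)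
  then show ?thesis
    by (meson of_nat_mono order_trans of_nat_div_le_of_nat)
qed

text \<open>Union bound over the gcd d of a pair that is not coprime: \<open>?D d\<close> holds at
  most a fraction 1/d^2 of all pairs, and these fractions sum to at most 3/4.\<close>

lemma card_coprime_ge:
  "real N * real M / 4 \<le> card {(x, y) \<in> {1..N} \<times> {1..M}. coprime x y}"
proof -
  let ?S = "{1..N} \<times> {1..M}"
  let ?C = "{(x, y) \<in> ?S. coprime x y}"
  let ?D = "\<lambda>d. {x \<in> {1..N}. d dvd x} \<times> {y \<in> {1..M}. d dvd y}"
  have "?S \<subseteq> ?C \<union> (\<Union>d\<in>{2..M}. ?D d)"
  proof
    fix z assume z: "z \<in> ?S"
    obtain x y where xy: "z = (x, y)" by (cases z)
    show "z \<in> ?C \<union> (\<Union>d\<in>{2..M}. ?D d)"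
    proof (cases "coprime x y")
      case False
      then have "gcd x y \<noteq> 1" by (simp add: coprime_iff_gcd_eq_1)
      moreover have "gcd x y > 0" "gcd x y \<le> y" "y \<le> M" using z xy by (auto intro: dvd_imp_le)
      ultimately have "gcd x y \<in> {2..M}" unfolding atLeastAtMost_iff by linarith
      then show ?thesis using z xy by auto
    qed (use z xy in auto)
  qed
  then have "card ?S \<le> card (?C \<union> (\<Union>d\<in>{2..M}. ?D d))"
    by (intro card_mono) (auto intro: finite_subset[of _ ?S])
  also have "\<dots> \<le> card ?C + (\<Sum>d = 2..M. card (?D d))"
    by (intro order_trans[OF card_Un_le] add_left_mono card_UN_le) auto
  finally have "card ?S \<le> card ?C + (\<Sum>d = 2..M. card (?D d))" .
  from of_nat_mono[OF this, where 'a = real]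
  have "real (card ?S) \<le> real (card ?C) + (\<Sum>d = 2..M. real (card (?D d)))"
    by (simp only: of_nat_add of_nat_sum)
  moreover have "(\<Sum>d = 2..M. real (card (?D d))) \<le> (\<Sum>d = 2..M. real N * real M * (1 / (real d)\<^sup>2))"
  proof (rule sum_mono)
    fix d assume "d \<in> {2..M}"
    then have "real (card (?D d)) \<le> (real N / real d) * (real M / real d)"
      unfolding card_cartesian_product of_nat_mult by (intro mult_mono card_multiples) auto
    then show "real (card (?D d)) \<le> real N * real M * (1 / (real d)\<^sup>2)"
      by (simp add: power2_eq_square)
  qed
  moreover have "\<dots> \<le> real N * real M * (3 / 4)"
    unfolding sum_distrib_left[symmetric] by (intro mult_left_mono sum_inverse_squares_le) auto
  ultimately show ?thesis by simp
qed

text \<open>Removing the columns with x \<le> N / 8 costs at most half of the lower bound N * M / 4.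
  The remaining x are comparable to N, as \<open>ternary_sector_solutions\<close> requires.\<close>

lemma card_coprime_sector_ge:
  "real N * real M / 8 \<le> card {(x, y). x \<in> {1..N} \<and> y \<in> {1..M} \<and> N < 8 * x \<and> coprime x y}"
    (is "_ \<le> real (card ?C)")
proof -
  let ?E = "{1..N div 8} \<times> {1..M}"
  have "{(x, y) \<in> {1..N} \<times> {1..M}. coprime x y} \<subseteq> ?C \<union> ?E"
    by auto
  moreover have "finite ?C" by (rule finite_subset[of _ "{1..N} \<times> {1..M}"]) auto
  ultimately have "card {(x, y) \<in> {1..N} \<times> {1..M}. coprime x y} \<le> card (?C \<union> ?E)"
    by (intro card_mono) auto
  also have "\<dots> \<le> card ?C + (N div 8) * M"
    using card_Un_le[of ?C ?E] by simp
  finally have "card {(x, y) \<in> {1..N} \<times> {1..M}. coprime x y} \<le> card ?C + (N div 8) * M" .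
  from of_nat_mono[OF this, where 'a = real]
  have "real (card {(x, y) \<in> {1..N} \<times> {1..M}. coprime x y}) \<le> card ?C + real (N div 8) * M"
    by (simp only: of_nat_add of_nat_mult)
  moreover have "real (N div 8) * M \<le> real N / 8 * M"
    by (intro mult_right_mono) auto
  ultimately show ?thesis using card_coprime_ge[of N M] by simp
qed

text \<open>Distinct coprime pairs are not proportional; this supplies the linear independence
  behind the pairwise independent events.\<close>

lemma coprime_pair_eqI:
  fixes x y x' y' :: nat
  assumes "coprime x y" "coprime x' y'" "x * y' = x' * y" "x > 0" "x' > 0"
  shows "x = x' \<and> y = y'"
proof -
  have "x dvd x'" "x' dvd x"
    using assms by (metis coprime_dvd_mult_left_iff dvd_triv_left)+
  then have "x = x'" by (rule dvd_antisym)
  then show ?thesis using assms by simp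
qed

section \<open>Indefinite ternary forms\<close>

text \<open>The arguments a, b, c, d, e, f are the entries 11, 22, 33, 12, 13, 23 of a symmetric
  matrix. With scalars, the form on a vertical line (p and q fixed) is visibly a quadratic
  polynomial in z.\<close>

definition ternary :: "real \<Rightarrow> real \<Rightarrow> real \<Rightarrow> real \<Rightarrow> real \<Rightarrow> real \<Rightarrow> real \<Rightarrow> real \<Rightarrow> real \<Rightarrow> real" where
  "ternary a b c d e f p q z =
    a * p\<^sup>2 + b * q\<^sup>2 + c * z\<^sup>2 + 2 * d * p * q + 2 * e * p * z + 2 * f * q * z"

lemma ternary_uminus: "ternary (- a) (- b) (- c) (- d) (- e) (- f) p q z = - ternary a b c d e f p q z"
  by (simp add: ternary_def)

lemma ternary_scale: "ternary a b c d e f (t * p) (t * q) (t * z) = t\<^sup>2 * ternary a b c d e f p q z"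
  by (simp add: ternary_def power2_eq_square algebra_simps)

text \<open>Negativity is an open condition and invariant under scaling, so the real direction (p,
  q) can be replaced by an integer one. On the same vertical line large z give positive values
  because c > 0. The pair (m, n) is not zero, since above (0, 0) the form is c z^2 \<ge> 0.\<close>

lemma ternary_indefinite_plane_pos:
  assumes c: "c > 0" and neg: "ternary a b c d e f p q z < 0"
  shows "\<exists>(m::int) (n::int) z1 z2. (m, n) \<noteq> (0::int, 0::int) \<and>
    ternary a b c d e f m n z1 < 0 \<and> ternary a b c d e f m n z2 > 0"
proof -
  have fl: "((\<lambda>t. real_of_int \<lfloor>t * r\<rfloor> / t) \<longlongrightarrow> r) at_top" for r :: real
    by real_asymp
  have "((\<lambda>t. ternary a b c d e f (\<lfloor>t * p\<rfloor> / t) (\<lfloor>t * q\<rfloor> / t) z) \<longlongrightarrow> ternary a b c d e f p q z) at_top"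
    unfolding ternary_def by (intro tendsto_intros fl)
  then have "eventually (\<lambda>t. ternary a b c d e f (\<lfloor>t * p\<rfloor> / t) (\<lfloor>t * q\<rfloor> / t) z < 0) at_top"
    using neg by (rule order_tendstoD)
  then have "eventually (\<lambda>t. ternary a b c d e f (\<lfloor>t * p\<rfloor> / t) (\<lfloor>t * q\<rfloor> / t) z < 0 \<and> t > 0) at_top"
    using eventually_gt_at_top by (rule eventually_conj)
  then obtain t where t: "ternary a b c d e f (\<lfloor>t * p\<rfloor> / t) (\<lfloor>t * q\<rfloor> / t) z < 0" "t > 0"
    using eventually_happens'[OF trivial_limit_at_top_linorder] by blast
  define m n where "m = \<lfloor>t * p\<rfloor>" and "n = \<lfloor>t * q\<rfloor>"
  have m: "ternary a b c d e f m n (t * z) < 0"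
    using ternary_scale[of a b c d e f t "m / t" "n / t" z] t
    by (simp add: m_def n_def mult_pos_neg)
  define s r where "s = 2 * e * m + 2 * f * n" and "r = ternary a b c d e f m n 0"
  \<comment> \<open>Chosen so that \<open>c * w\<close> is
    \<open>c + \<bar>s\<bar> + \<bar>r\<bar>\<close>; the quadratic term then outweighs the linear
    and the constant one.\<close>
  define w where "w = 1 + (\<bar>s\<bar> + \<bar>r\<bar>) / c"
  have w: "w \<ge> 1" using c by (simp add: w_def)
  have "ternary a b c d e f m n w = (c * w) * w + s * w + r"
    by (simp add: ternary_def s_def r_def power2_eq_square algebra_simps)
  also have "c * w = c + \<bar>s\<bar> + \<bar>r\<bar>"
    using c by (simp add: w_def field_simps)
  also have "(c + \<bar>s\<bar> + \<bar>r\<bar>) * w + s * w + r = c * w + (\<bar>s\<bar> + s) * w + \<bar>r\<bar> * (w - 1) + (\<bar>r\<bar> + r)"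
    by (simp add: algebra_simps)
  also have "\<dots> > 0"
    using c w by (intro add_pos_nonneg mult_pos_pos mult_nonneg_nonneg) auto
  finally have "ternary a b c d e f m n w > 0" .
  moreover have "(m, n) \<noteq> (0::int, 0::int)"
    using m c by (auto simp: ternary_def mult_less_0_iff)
  ultimately show ?thesis using m by blast
qed

text \<open>If c > 0 the previous lemma applies at the negative point; if c < 0 it applies to the
  negated form at the positive point. If c = 0 the form is affine in z on vertical lines, and
  \<open>nondeg\<close> yields a coordinate direction with nonzero slope.\<close>

lemma ternary_indefinite_plane:
  assumes neg: "ternary a b c d e f p q z < 0" and pos: "ternary a b c d e f p' q' z' > 0"
    and nondeg: "c \<noteq> 0 \<or> e \<noteq> 0 \<or> f \<noteq> 0"
  shows "\<exists>(m::int) (n::int) z1 z2. (m, n) \<noteq> (0::int, 0::int) \<and>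
    ternary a b c d e f m n z1 < 0 \<and> ternary a b c d e f m n z2 > 0"
proof -
  consider "c > 0" | "c < 0" | "c = 0" by linarith
  then show ?thesis
  proof cases
    case 1
    then show ?thesis using ternary_indefinite_plane_pos[OF _ neg] by simp
  next
    case 2
    then have "- c > 0" "ternary (- a) (- b) (- c) (- d) (- e) (- f) p' q' z' < 0"
      using pos by (simp_all add: ternary_uminus)
    then obtain m n :: int and z1 z2 where "(m, n) \<noteq> (0::int, 0::int)"
      "ternary (- a) (- b) (- c) (- d) (- e) (- f) m n z1 < 0"
      "ternary (- a) (- b) (- c) (- d) (- e) (- f) m n z2 > 0"
      using ternary_indefinite_plane_pos[of "- c" "- a"] by metis
    then show ?thesis
      by (intro exI[of _ m] exI[of _ n] exI[of _ z2] exI[of _ z1]) (simp add: ternary_uminus)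
  next
    case 3
    define m n :: int where "m = (if e = 0 then 0 else 1)" and "n = (if e = 0 then 1 else 0)"
    define s r where "s = 2 * e * m + 2 * f * n" and "r = ternary a b c d e f m n 0"
    have s: "s \<noteq> 0" using nondeg 3 by (auto simp: s_def m_def n_def)
    have "ternary a b c d e f m n z = s * z + r" for z
      using 3 by (simp add: ternary_def s_def r_def algebra_simps)
    then have "ternary a b c d e f m n ((- 1 - r) / s) < 0" "ternary a b c d e f m n ((1 - r) / s) > 0"
      using s by simp_all
    moreover have "(m, n) \<noteq> (0::int, 0::int)" by (simp add: m_def n_def)
    ultimately show ?thesis
      by (intro exI[of _ m] exI[of _ n] exI[of _ "(- 1 - r) / s"] exI[of _ "(1 - r) / s"]) simp
  qed
qed

text \<open>
  In the coordinates \<open>x, y\<close> of the basis \<open>(m, n), (-n, m)\<close>, a thin sector around the first axis stays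
  in the region where the form restricted to a vertical line changes sign.
\<close>

lemma ternary_sector_solutions:
  fixes m n :: real
  assumes neg: "ternary a b c d e f m n z1 < 0" and pos: "ternary a b c d e f m n z2 > 0"
  shows "\<exists>\<delta>>0. \<delta> \<le> 1 \<and> (\<exists>C\<ge>1. \<forall>N x y \<epsilon>. C \<le> N \<and> N / 8 \<le> x \<and> x \<le> N \<and> 0 \<le> y \<and> y \<le> \<delta> * N \<and> 0 < \<epsilon> \<and> \<epsilon> \<le> 1 \<longrightarrow>
    (\<exists>z0. \<bar>z0\<bar> \<le> C * N \<and> (\<forall>s. 0 \<le> s \<and> s \<le> \<epsilon> / (C * N) \<longrightarrow>
      \<bar>ternary a b c d e f (x * m - y * n) (x * n + y * m) (z0 + s) - \<xi>\<bar> < \<epsilon>)))"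
proof -
  let ?F = "ternary a b c d e f"
  \<comment> \<open>A margin that survives small changes of direction and, scaled by x^2, will
    exceed \<open>\<bar>\<xi>\<bar>\<close>.\<close>
  define \<eta> where "\<eta> = min (- ?F m n z1) (?F m n z2) / 2"
  have \<eta>: "\<eta> > 0" "?F m n z1 < - \<eta>" "?F m n z2 > \<eta>"
    using neg pos by (auto simp: \<eta>_def min_def)
  have lim: "((\<lambda>s. ?F (m - s * n) (n + s * m) z) \<longlongrightarrow> ?F (m - 0 * n) (n + 0 * m) z) (nhds 0)" for z
    unfolding ternary_def by (intro tendsto_intros filterlim_ident)
  have "eventually (\<lambda>s. ?F (m - s * n) (n + s * m) z1 < - \<eta> \<and> ?F (m - s * n) (n + s * m) z2 > \<eta>) (nhds 0)"
    using \<eta> by (intro eventually_conj order_tendstoD[OF lim]) auto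
  then obtain \<delta>' where \<delta>': "\<delta>' > 0" and
    \<delta>'s: "\<And>s. \<bar>s\<bar> < \<delta>' \<Longrightarrow> ?F (m - s * n) (n + s * m) z1 < - \<eta> \<and> ?F (m - s * n) (n + s * m) z2 > \<eta>"
    unfolding eventually_nhds_metric by (auto simp: dist_real_def)
  \<comment> \<open>In the sector y / x \<le> \<delta> N / (N / 8) = 8 \<delta>, so the factor 1/16
    keeps the slope strictly below \<delta>'.\<close>
  define \<delta> where "\<delta> = min 1 (\<delta>' / 16)"
  have \<delta>: "\<delta> > 0" "\<delta> \<le> 1" "8 * \<delta> < \<delta>'" using \<delta>' by (auto simp: \<delta>_def min_def)
  define Z where "Z = max \<bar>z1\<bar> \<bar>z2\<bar>"
  define W where "W = \<bar>m\<bar> + \<bar>n\<bar>"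
  define L where "L = 2 * \<bar>c\<bar> * Z + \<bar>c\<bar> + 2 * \<bar>e\<bar> * W + 2 * \<bar>f\<bar> * W"
  \<comment> \<open>One constant for four demands: 8 gives x \<ge> 1, \<open>2 * L\<close> keeps the
    form within \<epsilon> of \<xi> on the interval of length \<open>\<epsilon> / (C * N)\<close>, Z
    bounds the root z0, and the last term gives \<eta> x \<ge>
    \<open>\<bar>\<xi>\<bar>\<close>.\<close>
  define C where "C = 8 + 2 * L + Z + 8 * \<bar>\<xi>\<bar> / \<eta>"
  have "Z \<ge> 0" "W \<ge> 0" by (simp_all add: Z_def W_def le_max_iff_disj)
  moreover from this have "L \<ge> 0"
    unfolding L_def by (intro add_nonneg_nonneg mult_nonneg_nonneg) auto
  moreover have "\<bar>\<xi>\<bar> / \<eta> \<ge> 0" using \<eta> by simp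
  ultimately have nn: "Z \<ge> 0" "W \<ge> 0" "L \<ge> 0" "\<bar>\<xi>\<bar> / \<eta> \<ge> 0" .
  have C: "C \<ge> 8" "C > 2 * L" "C \<ge> Z" "C \<ge> 8 * \<bar>\<xi>\<bar> / \<eta>" using nn by (auto simp: C_def)
  have "\<exists>z0. \<bar>z0\<bar> \<le> C * N \<and> (\<forall>s. 0 \<le> s \<and> s \<le> \<epsilon> / (C * N) \<longrightarrow>
      \<bar>?F (x * m - y * n) (x * n + y * m) (z0 + s) - \<xi>\<bar> < \<epsilon>)"
    if N: "C \<le> N" and x: "N / 8 \<le> x" "x \<le> N" and y: "0 \<le> y" "y \<le> \<delta> * N"
      and \<epsilon>: "0 < \<epsilon>" "\<epsilon> \<le> 1" for N x y \<epsilon>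
  proof -
    have x1: "x \<ge> 1" "x \<ge> \<bar>\<xi>\<bar> / \<eta>" using C N x by auto
    define g where "g z = ?F (x * m - y * n) (x * n + y * m) z" for z
    have "\<delta> * N \<le> \<delta> * (8 * x)" using x \<delta> by (intro mult_left_mono) auto
    then have "y \<le> (8 * \<delta>) * x" using y by (simp add: mult_ac)
    then have "y / x \<le> 8 * \<delta>" using x1 by (subst pos_divide_le_eq) auto
    then have "\<bar>y / x\<bar> < \<delta>'" using x1 y \<delta> by simp
    from \<delta>'s[OF this] have sgn: "?F (m - y / x * n) (n + y / x * m) z1 < - \<eta>" "?F (m - y / x * n) (n + y / x * m) z2 > \<eta>"
      by auto
    have gx: "g (x * z) = x\<^sup>2 * ?F (m - y / x * n) (n + y / x * m) z" for z
      using ternary_scale[of a b c d e f x "m - y / x * n" "n + y / x * m" z] x1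
      by (simp add: g_def algebra_simps)
    have "\<bar>\<xi>\<bar> \<le> \<eta> * x" using x1 \<eta> by (simp add: field_simps)
    also have "\<dots> \<le> \<eta> * x\<^sup>2" using x1 \<eta> by (intro mult_left_mono) (auto simp: power2_eq_square)
    finally have \<xi>: "\<bar>\<xi>\<bar> \<le> x\<^sup>2 * \<eta>" by (simp add: mult.commute)
    have "g (x * z1) \<le> x\<^sup>2 * (- \<eta>)" "x\<^sup>2 * \<eta> \<le> g (x * z2)"
      unfolding gx using sgn by (intro mult_left_mono; simp)+
    then have ends: "g (x * z1) \<le> \<xi>" "\<xi> \<le> g (x * z2)" using \<xi> by linarith+
    have cont: "continuous_on A g" for A
      unfolding g_def ternary_def by (intro continuous_intros)
    have xZ: "- (x * Z) \<le> x * z" "x * z \<le> x * Z" if "\<bar>z\<bar> \<le> Z" for z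
      using x1 that mult_left_mono[of "- Z" z x] by auto
    have "\<bar>z1\<bar> \<le> Z" "\<bar>z2\<bar> \<le> Z" by (simp_all add: Z_def)
    note xZ = xZ[OF this(1)] xZ[OF this(2)]
    \<comment> \<open>The values at \<open>x * z1\<close> and \<open>x * z2\<close> straddle \<xi>,
      so the intermediate value theorem gives a root, whichever end is the smaller.\<close>
    have "\<exists>z0. g z0 = \<xi> \<and> \<bar>z0\<bar> \<le> x * Z"
    proof (cases "z1 \<le> z2")
      case True
      then have "x * z1 \<le> x * z2" using x1 by simp
      from IVT'[OF ends this cont] obtain z0 where "x * z1 \<le> z0" "z0 \<le> x * z2" "g z0 = \<xi>" by blast
      then show ?thesis using xZ by (intro exI[of _ z0]) linarith
    next
      case False
      then have "x * z2 \<le> x * z1" using x1 by simp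
      from IVT2'[OF ends this cont] obtain z0 where "x * z2 \<le> z0" "z0 \<le> x * z1" "g z0 = \<xi>" by blast
      then show ?thesis using xZ by (intro exI[of _ z0]) linarith
    qed
    then obtain z0 where z0: "g z0 = \<xi>" "\<bar>z0\<bar> \<le> x * Z" by blast
    have N1: "N \<ge> 1" "N > 0" "C > 0" using C N by auto
    have z0N: "\<bar>z0\<bar> \<le> N * Z" using z0 mult_right_mono[OF x(2) nn(1)] by linarith
    have "\<delta> * N \<le> 1 * N" using \<delta> N1 by (intro mult_right_mono) auto
    then have yN: "y \<le> N" using y by simp
    have p: "\<bar>x * m - y * n\<bar> \<le> N * W" "\<bar>x * n + y * m\<bar> \<le> N * W"
    proof -
      have "\<bar>x * u\<bar> \<le> N * \<bar>u\<bar>" "\<bar>y * u\<bar> \<le> N * \<bar>u\<bar>" for u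
        using x x1 y yN by (auto simp: abs_mult intro!: mult_right_mono)
      from this[of m] this[of n] show "\<bar>x * m - y * n\<bar> \<le> N * W" "\<bar>x * n + y * m\<bar> \<le> N * W"
        unfolding W_def distrib_left by linarith+
    qed
    have "\<bar>g (z0 + s) - \<xi>\<bar> < \<epsilon>" if s: "0 \<le> s" "s \<le> \<epsilon> / (C * N)" for s
    proof -
      have CN: "1 * 1 \<le> C * N" using C(1) N1 by (intro mult_mono) auto
      then have "\<epsilon> / (C * N) \<le> 1" using \<epsilon> by (subst pos_divide_le_eq) auto
      then have s1: "s \<le> N" using s N1 by linarith
      \<comment> \<open>The difference quotient of g at z0 with increment s. It is of order N, so a
        step of order \<epsilon> / N moves g by less than \<epsilon>.\<close>
      define B where "B = 2 * c * z0 + c * s + 2 * e * (x * m - y * n) + 2 * f * (x * n + y * m)"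
      have "g (z0 + s) - g z0 = s * B"
        by (simp add: g_def ternary_def B_def power2_eq_square algebra_simps)
      have "\<bar>B\<bar> \<le> 2 * \<bar>c\<bar> * \<bar>z0\<bar> + \<bar>c\<bar> * s + 2 * \<bar>e\<bar> * \<bar>x * m - y * n\<bar> + 2 * \<bar>f\<bar> * \<bar>x * n + y * m\<bar>"
      proof -
        have "\<bar>t1 + t2 + t3 + t4\<bar> \<le> \<bar>t1\<bar> + \<bar>t2\<bar> + \<bar>t3\<bar> + \<bar>t4\<bar>" for t1 t2 t3 t4 :: real
          by linarith
        from this[of "2 * c * z0" "c * s" "2 * e * (x * m - y * n)" "2 * f * (x * n + y * m)"]
        show ?thesis using s by (simp only: B_def abs_mult abs_of_nonneg abs_numeral)
      qed
      also have "\<dots> \<le> 2 * \<bar>c\<bar> * (N * Z) + \<bar>c\<bar> * N + 2 * \<bar>e\<bar> * (N * W) + 2 * \<bar>f\<bar> * (N * W)"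
        using z0N s1 p by (intro add_mono mult_left_mono) auto
      also have "\<dots> = N * L" by (simp add: L_def algebra_simps)
      finally have B: "\<bar>B\<bar> \<le> N * L" .
      have "\<bar>g (z0 + s) - \<xi>\<bar> = s * \<bar>B\<bar>"
        using z0 s \<open>g (z0 + s) - g z0 = s * B\<close> by (simp add: abs_mult)
      also have "\<dots> \<le> (\<epsilon> / (C * N)) * (N * L)"
        using s B nn N1 \<epsilon> by (intro mult_mono) auto
      also have "\<dots> = \<epsilon> * (L / C)" using N1 by simp
      also have "\<dots> < \<epsilon> * 1" using \<epsilon> C nn N1 by (intro mult_strict_left_mono) (auto simp: divide_less_eq)
      finally show ?thesis by simp
    qed
    moreover have "N * Z \<le> N * C" using C N1 by (intro mult_left_mono) auto
    then have "\<bar>z0\<bar> \<le> C * N" using z0N by (simp add: mult.commute)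
    ultimately show ?thesis unfolding g_def by (intro exI[of _ z0]) simp
  qed
  then have "\<exists>C\<ge>1. \<forall>N x y \<epsilon>. C \<le> N \<and> N / 8 \<le> x \<and> x \<le> N \<and> 0 \<le> y \<and> y \<le> \<delta> * N \<and> 0 < \<epsilon> \<and> \<epsilon> \<le> 1 \<longrightarrow>
    (\<exists>z0. \<bar>z0\<bar> \<le> C * N \<and> (\<forall>s. 0 \<le> s \<and> s \<le> \<epsilon> / (C * N) \<longrightarrow>
      \<bar>ternary a b c d e f (x * m - y * n) (x * n + y * m) (z0 + s) - \<xi>\<bar> < \<epsilon>))"
    using C by (intro exI[of _ C]) simp
  then show ?thesis using \<delta>(1,2) by (intro exI[of _ \<delta>]) simp
qed

section \<open>Exceptional sets of shears\<close>

abbreviation torus :: "(real \<times> real) measure" where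
  "torus \<equiv> unif \<Otimes>\<^sub>M unif"

lemma space_torus: "space torus = UNIV"
  by (simp add: space_pair_measure)

lemma prob_space_torus: "prob_space torus"
proof -
  interpret U: prob_space unif by (rule prob_space_unif)
  interpret UU: pair_prob_space unif unif ..
  show ?thesis by unfold_locales
qed

text \<open>Those \<theta> for which some integer translate of
  \<open>p * fst \<theta> + q * snd \<theta>\<close> lies in [c, c + r].\<close>

definition slab :: "int \<Rightarrow> int \<Rightarrow> real \<Rightarrow> real \<Rightarrow> (real \<times> real) set" where
  "slab p q c r = {\<theta>. frac (p * fst \<theta> + q * snd \<theta> - c) \<le> r}"

lemma sets_slab [measurable]: "slab p q c r \<in> sets torus"
proof -
  have "slab p q c r = {\<theta> \<in> space torus. p * fst \<theta> + q * snd \<theta> - c - \<lfloor>p * fst \<theta> + q * snd \<theta> - c\<rfloor> \<le> r}"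
    by (simp add: slab_def frac_def space_torus)
  also have "\<dots> \<in> sets torus" by measurable
  finally show ?thesis .
qed

text \<open>The second factor stays general: the constant 1 gives the measure of one slab, and the
  indicator of an interval modulo 1 that of an intersection of two.\<close>

lemma nn_integral_slab:
  fixes f :: "real \<Rightarrow> ennreal" and p q p' q' :: int
  assumes r: "0 \<le> r" "r < 1" and det: "p * q' \<noteq> p' * q"
    and f [measurable]: "f \<in> borel_measurable borel" and per: "\<And>t. f (t + 1) = f t"
  shows "(\<integral>\<^sup>+ \<theta>. indicator (slab p q c r) \<theta> * f (p' * fst \<theta> + q' * snd \<theta>) \<partial>torus) = ennreal r * (\<integral>\<^sup>+ t. f t \<partial>unif)"
proof -
  interpret U: prob_space unif by (rule prob_space_unif)
  let ?g = "indicator {t. frac (t - c) \<le> r} :: real \<Rightarrow> ennreal"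
  have [measurable]: "{t::real. frac (t - c) \<le> r} \<in> sets borel" by (simp add: frac_def)
  have per': "?g (t + 1) = ?g t" for t
    using frac_1_eq[of "t - c"] by (auto simp: add_diff_eq[symmetric] diff_add_eq split: split_indicator)
  have "(\<integral>\<^sup>+ \<theta>. indicator (slab p q c r) \<theta> * f (p' * fst \<theta> + q' * snd \<theta>) \<partial>torus)
    = (\<integral>\<^sup>+ x. \<integral>\<^sup>+ y. indicator (slab p q c r) (x, y) * f (p' * fst (x, y) + q' * snd (x, y)) \<partial>unif \<partial>unif)"
    by (rule U.nn_integral_fst[symmetric]) measurable
  also have "\<dots> = (\<integral>\<^sup>+ x. \<integral>\<^sup>+ y. ?g (p * x + q * y) * f (p' * x + q' * y) \<partial>unif \<partial>unif)"
    by (intro nn_integral_cong) (auto simp: slab_def split: split_indicator)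
  also have "\<dots> = (\<integral>\<^sup>+ t. ?g t \<partial>unif) * (\<integral>\<^sup>+ t. f t \<partial>unif)"
    by (rule nn_integral_unif_independent) (use per per' det in auto)
  finally show ?thesis using r by (simp add: emeasure_unif_frac_le)
qed

lemma measure_slab:
  assumes "0 \<le> r" "r < 1" and "(p, q) \<noteq> (0, 0)"
  shows "measure torus (slab p q c r) = r"
proof -
  interpret U: prob_space unif by (rule prob_space_unif)
  \<comment> \<open>The auxiliary form (-q, p) has determinant p^2 + q^2 with (p, q); it is paired
    with the constant function 1.\<close>
  have "p * p \<noteq> (- q) * q"
    using assms(3) sum_squares_eq_zero_iff[of p q] by (auto simp: eq_neg_iff_add_eq_0)
  then have "emeasure torus (slab p q c r) = ennreal r"
    using nn_integral_slab[OF assms(1,2), of p p "- q" q "\<lambda>_. 1" c] U.emeasure_space_1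
    by (simp add: nn_integral_indicator[OF sets_slab])
  then show ?thesis using assms by (simp add: measure_def)
qed

lemma measure_slab_Int:
  fixes p q p' q' :: int
  assumes r: "0 \<le> r" "r < 1" and det: "p * q' \<noteq> p' * q"
  shows "measure torus (slab p q c r \<inter> slab p' q' c' r) = r\<^sup>2"
proof -
  let ?g = "indicator {t. frac (t - c') \<le> r} :: real \<Rightarrow> ennreal"
  have [measurable]: "{t::real. frac (t - c') \<le> r} \<in> sets borel" by (simp add: frac_def)
  have per: "?g (t + 1) = ?g t" for t
    using frac_1_eq[of "t - c'"] by (auto simp: add_diff_eq[symmetric] diff_add_eq split: split_indicator)
  have "emeasure torus (slab p q c r \<inter> slab p' q' c' r)
      = (\<integral>\<^sup>+ \<theta>. indicator (slab p q c r \<inter> slab p' q' c' r) \<theta> \<partial>torus)"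
    by (rule nn_integral_indicator[symmetric]) measurable
  also have "\<dots> = (\<integral>\<^sup>+ \<theta>. indicator (slab p q c r) \<theta> * ?g (p' * fst \<theta> + q' * snd \<theta>) \<partial>torus)"
    by (intro nn_integral_cong) (auto simp: slab_def split: split_indicator)
  also have "\<dots> = ennreal r * ennreal r"
    using nn_integral_slab[OF r det, of ?g c] per r by (simp add: emeasure_unif_frac_le)
  finally show ?thesis
    using r by (simp add: measure_def ennreal_mult[symmetric] power2_eq_square)
qed

text \<open>Each coprime (x, y) in the sector contributes a slab of width r = \<epsilon> / (C N). At
  least \<delta> N^2 / 16 such pairwise independent events exist, so by \<open>prob_none_le\<close>
  all of them fail with probability at most 16 / (\<delta> N^2 r) = 16 C / (\<delta> N
  \<epsilon>).\<close>

lemma torus_exceptional_set: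
  fixes m n :: int
  assumes neg: "ternary a b c d e f m n z1 < 0" and pos: "ternary a b c d e f m n z2 > 0"
    and mn: "(m, n) \<noteq> (0, 0)"
  shows "\<exists>K::real. 1 \<le> K \<and> (\<forall>(N::nat) (\<epsilon>::real). K \<le> real N \<and> 0 < \<epsilon> \<and> \<epsilon> \<le> 1 \<longrightarrow>
    (\<exists>E\<in>sets torus. measure torus E \<le> K / (real N * \<epsilon>) \<and>
      (\<forall>\<theta>\<in>{0..<1} \<times> {0..<1} - E. \<exists>(i::int) (j::int) (k::int). (i, j) \<noteq> (0::int, 0::int) \<and>
        \<bar>ternary a b c d e f i j (k + (i * fst \<theta> + j * snd \<theta>)) - \<xi>\<bar> < \<epsilon> \<and>
        \<bar>i\<bar> \<le> K * real N \<and> \<bar>j\<bar> \<le> K * real N \<and> \<bar>k\<bar> \<le> K * real N)))"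
proof -
  interpret T: prob_space torus by (rule prob_space_torus)
  obtain \<delta> C where \<delta>: "\<delta> > 0" "\<delta> \<le> 1" and C: "C \<ge> 1" and
    sol: "\<And>N x y \<epsilon> :: real. C \<le> N \<Longrightarrow> N / 8 \<le> x \<Longrightarrow> x \<le> N \<Longrightarrow> 0 \<le> y \<Longrightarrow> y \<le> \<delta> * N \<Longrightarrow> 0 < \<epsilon> \<Longrightarrow> \<epsilon> \<le> 1 \<Longrightarrow>
    \<exists>z0. \<bar>z0\<bar> \<le> C * N \<and> (\<forall>s. 0 \<le> s \<and> s \<le> \<epsilon> / (C * N) \<longrightarrow>
      \<bar>ternary a b c d e f (x * real_of_int m - y * real_of_int n) (x * real_of_int n + y * real_of_int m) (z0 + s) - \<xi>\<bar> < \<epsilon>)"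
    using ternary_sector_solutions[OF neg pos, of \<xi>] by metis
  define W where "W = real_of_int (\<bar>m\<bar> + \<bar>n\<bar>)"
  \<comment> \<open>Collects the threshold C for N, the coordinate bounds W and C + 1 + 2 W, and the
    probability constant 16 C / \<delta>, which also bounds 2 / \<delta>.\<close>
  define K where "K = 1 + C + 2 * W + 16 * C / \<delta>"
  have "W \<ge> 0" by (simp add: W_def)
  have "16 / \<delta> \<le> 16 * C / \<delta>" using C \<delta> by (simp add: divide_right_mono)
  moreover have "2 / \<delta> \<le> 16 / \<delta>" using \<delta> by (simp add: divide_right_mono)
  moreover have "2 \<le> 2 / \<delta>" using \<delta> by (simp add: field_simps)
  ultimately have K: "K \<ge> 1" "K \<ge> C" "K \<ge> W" "K \<ge> C + 1 + 2 * W" "K \<ge> 16 * C / \<delta>" "K \<ge> 2 / \<delta>" "K \<ge> 2"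
    using C \<open>W \<ge> 0\<close> by (auto simp: K_def)
  have "\<exists>E\<in>sets torus. measure torus E \<le> K / (real N * \<epsilon>) \<and>
      (\<forall>\<theta>\<in>{0..<1} \<times> {0..<1} - E. \<exists>(i::int) (j::int) (k::int). (i, j) \<noteq> (0::int, 0::int) \<and>
        \<bar>ternary a b c d e f i j (k + (i * fst \<theta> + j * snd \<theta>)) - \<xi>\<bar> < \<epsilon> \<and>
        \<bar>i\<bar> \<le> K * real N \<and> \<bar>j\<bar> \<le> K * real N \<and> \<bar>k\<bar> \<le> K * real N)"
    if N: "K \<le> real N" and \<epsilon>: "0 < \<epsilon>" "\<epsilon> \<le> 1" for N :: nat and \<epsilon> :: real
  proof -
    \<comment> \<open>Height of the sector. Since \<delta> N \<ge> 2, rounding down loses at most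
      half of it.\<close>
    define M where "M = nat \<lfloor>\<delta> * N\<rfloor>"
    have "2 / \<delta> \<le> N" using K N by linarith
    then have \<delta>N: "2 \<le> \<delta> * N" using \<delta> by (simp add: field_simps)
    then have M: "\<delta> * N / 2 \<le> real M" "real M \<le> \<delta> * N"
      unfolding M_def by linarith+
    have "\<delta> * N \<le> 1 * real N" using \<delta> by (intro mult_right_mono) auto
    then have MN: "M \<le> N" using M by simp
    define I where "I = {(x, y). x \<in> {1..N} \<and> y \<in> {1..M} \<and> N < 8 * x \<and> coprime x y}"
    have finI: "finite I"
      by (rule finite_subset[of _ "{1..N} \<times> {1..M}"]) (auto simp: I_def)
    have "real N * (\<delta> * N / 2) / 8 \<le> real N * real M / 8"
      using M by (intro divide_right_mono mult_left_mono) auto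
    also have "\<dots> \<le> card I" unfolding I_def by (rule card_coprime_sector_ge)
    finally have cardI: "\<delta> * N * N / 16 \<le> card I" by (simp add: mult_ac)
    define r where "r = \<epsilon> / (C * N)"
    have N2: "N \<ge> 2" using K N by simp
    have "1 * 2 \<le> C * real N" using C N2 by (intro mult_mono) auto
    then have r: "0 < r" "r < 1"
      using \<epsilon> unfolding r_def by (simp_all add: divide_less_eq)
    have "\<forall>x y. \<exists>z0::real. (x, y) \<in> I \<longrightarrow> \<bar>z0\<bar> \<le> C * N \<and> (\<forall>s. 0 \<le> s \<and> s \<le> r \<longrightarrow>
      \<bar>ternary a b c d e f (real x * m - real y * n) (real x * n + real y * m) (z0 + s) - \<xi>\<bar> < \<epsilon>)"
    proof (intro allI)
      fix x y
      show "\<exists>z0. (x, y) \<in> I \<longrightarrow> \<bar>z0\<bar> \<le> C * N \<and> (\<forall>s. 0 \<le> s \<and> s \<le> r \<longrightarrow>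
        \<bar>ternary a b c d e f (real x * m - real y * n) (real x * n + real y * m) (z0 + s) - \<xi>\<bar> < \<epsilon>)"
      proof (cases "(x, y) \<in> I")
        case True
        then have "real N / 8 \<le> real x" "real x \<le> N" "real y \<le> \<delta> * N"
          using M by (auto simp: I_def)
        then show ?thesis
          using sol[of N x y \<epsilon>] \<epsilon> K N unfolding r_def by auto
      qed simp
    qed
    then obtain z0 where z0: "\<And>x y. (x, y) \<in> I \<Longrightarrow> \<bar>z0 x y\<bar> \<le> C * N"
      and z0s: "\<And>x y s. (x, y) \<in> I \<Longrightarrow> 0 \<le> s \<Longrightarrow> s \<le> r \<Longrightarrow>
      \<bar>ternary a b c d e f (real x * m - real y * n) (real x * n + real y * m) (z0 x y + s) - \<xi>\<bar> < \<epsilon>"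
      by metis
    \<comment> \<open>The integer vector x (m, n) + y (-n, m). This change of basis has determinant
      m^2 + n^2, so linear independence of the pairs (x, y) is preserved.\<close>
    define i where "i x y = int x * m - int y * n" for x y
    define j where "j x y = int x * n + int y * m" for x y
    define A where "A = (\<lambda>(x, y). slab (i x y) (j x y) (z0 x y) r)"
    have mn2: "m * m + n * n \<noteq> 0"
      using mn sum_squares_eq_zero_iff[of m n] by auto
    have det: "i x y * j x' y' - i x' y' * j x y = (m * m + n * n) * (int (x * y') - int (x' * y))" for x y x' y'
      by (simp add: i_def j_def algebra_simps)
    have ij: "(i x y, j x y) \<noteq> (0, 0)" if "(x, y) \<in> I" for x y
    proof
      assume "(i x y, j x y) = (0, 0)"
      \<comment> \<open>The determinant against the pair (0, 1) isolates x, which is positive on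
        I.\<close>
      then have "(m * m + n * n) * int x = 0"
        using det[of x y 0 1] by simp
      then show False using mn2 that by (auto simp: I_def)
    qed
    define E where "E = space torus - (\<Union>t\<in>I. A t)"
    have sA [measurable]: "A t \<in> sets torus" for t
      by (cases t) (simp only: A_def prod.case sets_slab)
    have "I \<noteq> {}"
    proof
      assume "I = {}"
      moreover have "\<delta> * N * N / 16 > 0" using \<delta> N2 by simp
      ultimately show False using cardI by simp
    qed
    have probA: "T.prob (A t) = r" if "t \<in> I" for t
      using that r by (cases t) (auto simp: A_def intro!: measure_slab dest: ij)
    have pairA: "T.prob (A t \<inter> A t') = r\<^sup>2" if "t \<in> I" "t' \<in> I" "t \<noteq> t'" for t t'
    proof -
      obtain x y x' y' where t: "t = (x, y)" "t' = (x', y')" by fastforce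
      have "x * y' \<noteq> x' * y"
        using coprime_pair_eqI[of x y x' y'] that by (auto simp: t I_def)
      then have "int (x * y') - int (x' * y) \<noteq> 0" by (metis eq_iff_diff_eq_0 of_nat_eq_iff)
      then have "i x y * j x' y' \<noteq> i x' y' * j x y"
        using det[of x y x' y'] mn2 by (metis eq_iff_diff_eq_0 mult_eq_0_iff)
      then show ?thesis using r by (simp add: t A_def measure_slab_Int)
    qed
    have "T.prob E \<le> 1 / (card I * r)"
      unfolding E_def by (intro T.prob_none_le[OF finI sA probA pairA r(1) \<open>I \<noteq> {}\<close>])
    also have "\<dots> \<le> 1 / ((\<delta> * N * N / 16) * r)"
      using cardI \<delta> N2 r finI \<open>I \<noteq> {}\<close> by (intro divide_left_mono mult_right_mono mult_pos_pos) (auto simp: card_gt_0_iff)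
    also have "\<dots> = (16 * C / \<delta>) / (N * \<epsilon>)"
      using N2 \<delta> \<epsilon> C by (simp add: r_def field_simps)
    also have "\<dots> \<le> K / (real N * \<epsilon>)"
      using K \<epsilon> by (intro divide_right_mono) auto
    finally have "T.prob E \<le> K / (real N * \<epsilon>)" .
    moreover have "E \<in> sets torus" unfolding E_def using finI by measurable
    moreover have "\<exists>(i::int) (j::int) (k::int). (i, j) \<noteq> (0::int, 0::int) \<and>
        \<bar>ternary a b c d e f i j (k + (i * fst \<theta> + j * snd \<theta>)) - \<xi>\<bar> < \<epsilon> \<and>
        \<bar>i\<bar> \<le> K * real N \<and> \<bar>j\<bar> \<le> K * real N \<and> \<bar>k\<bar> \<le> K * real N"
      if \<theta>: "\<theta> \<in> {0..<1} \<times> {0..<1} - E" for \<theta> :: "real \<times> real"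
    proof -
      obtain x y where xy: "(x, y) \<in> I" and "\<theta> \<in> A (x, y)"
        using \<theta> by (auto simp: E_def space_torus)
      \<comment> \<open>Lying in the slab means that t exceeds z0 by s \<le> r modulo 1; the integer
        k carries t into the interval of good z.\<close>
      define t where "t = i x y * fst \<theta> + j x y * snd \<theta>"
      define k where "k = - \<lfloor>t - z0 x y\<rfloor>"
      define s where "s = frac (t - z0 x y)"
      have s: "0 \<le> s" "s \<le> r" and kt: "k + t = z0 x y + s"
        using \<open>\<theta> \<in> A (x, y)\<close> by (simp_all add: A_def slab_def t_def s_def k_def frac_def)
      have ineq: "\<bar>ternary a b c d e f (i x y) (j x y) (k + t) - \<xi>\<bar> < \<epsilon>"
        using z0s[OF xy s] unfolding kt by (simp add: i_def j_def)
      have bnd: "\<bar>int x * u\<bar> \<le> int N * \<bar>u\<bar>" "\<bar>int y * u\<bar> \<le> int N * \<bar>u\<bar>" for u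
        using xy MN by (auto simp: I_def abs_mult intro!: mult_right_mono)
      have "\<bar>i x y\<bar> \<le> int N * (\<bar>m\<bar> + \<bar>n\<bar>)" "\<bar>j x y\<bar> \<le> int N * (\<bar>m\<bar> + \<bar>n\<bar>)"
        using bnd[of m] bnd[of n] unfolding i_def j_def distrib_left by linarith+
      then have "real_of_int \<bar>i x y\<bar> \<le> real_of_int (int N * (\<bar>m\<bar> + \<bar>n\<bar>))"
        "real_of_int \<bar>j x y\<bar> \<le> real_of_int (int N * (\<bar>m\<bar> + \<bar>n\<bar>))"
        unfolding of_int_le_iff by auto
      then have ijW: "\<bar>real_of_int (i x y)\<bar> \<le> N * W" "\<bar>real_of_int (j x y)\<bar> \<le> N * W"
        by (simp_all add: W_def)
      have NW: "N * W \<le> K * N" using mult_right_mono[OF K(3), of N] by (simp add: mult.commute)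
      have \<theta>1: "\<bar>u * fst \<theta>\<bar> \<le> \<bar>u\<bar>" "\<bar>u * snd \<theta>\<bar> \<le> \<bar>u\<bar>" for u
        using \<theta> mult_left_mono[of _ 1 "\<bar>u\<bar>"] by (auto simp: abs_mult)
      have "\<bar>t\<bar> \<le> 2 * (N * W)"
        unfolding t_def using \<theta>1[of "i x y"] \<theta>1[of "j x y"] ijW by linarith
      moreover have "\<bar>s\<bar> \<le> 1" "\<bar>z0 x y\<bar> \<le> C * N" using s r z0[OF xy] by auto
      ultimately have "\<bar>real_of_int k\<bar> \<le> C * N + 1 + 2 * (N * W)"
        using kt by linarith
      also have "\<dots> \<le> C * N + 1 * N + 2 * (N * W)" using N2 by simp
      also have "\<dots> = (C + 1 + 2 * W) * N" by (simp add: algebra_simps)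
      also have "\<dots> \<le> K * N" using K by (intro mult_right_mono) auto
      finally have "\<bar>real_of_int k\<bar> \<le> K * real N" .
      with ineq ij[OF xy] ijW NW show ?thesis
        unfolding t_def by (intro exI[of _ "i x y"] exI[of _ "j x y"] exI[of _ k]) simp
    qed
    ultimately show ?thesis by (intro bexI[of _ E]) auto
  qed
  then show ?thesis using K(1) by (intro exI[of _ K]) simp
qed

section \<open>Borel-Cantelli along dyadic scales\<close>

lemma AE_torus: "AE \<theta> in torus. \<theta> \<in> {0..<1} \<times> {0..<1}"
proof -
  interpret U: prob_space unif by (rule prob_space_unif)
  interpret UU: pair_sigma_finite unif unif ..
  have "AE x in unif. AE y in unif. (x, y) \<in> {0..<1} \<times> {0..<1}"
    using AE_unif by eventually_elim (use AE_unif in auto)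
  moreover have "{0..<1} \<times> {0..<1} \<in> sets torus" by (rule pair_measureI) auto
  ultimately show ?thesis
    by (intro UU.AE_pair_measure) (simp_all add: space_torus)
qed

text \<open>Take \<epsilon> = 2^-(k+1) and N of order \<open>R k\<close>. The exceptional sets have
  measure at most a constant times \<open>(2 / 2 powr \<kappa>) ^ k\<close>, a convergent geometric
  series because \<kappa> > 1.\<close>

lemma torus_AE_eventually:
  fixes m n :: int
  assumes neg: "ternary a b c d e f m n z1 < 0" and pos: "ternary a b c d e f m n z2 > 0"
    and mn: "(m, n) \<noteq> (0, 0)" and \<kappa>: "\<kappa> > 1"
  shows "AE \<theta> in torus. \<exists>k0. \<forall>k\<ge>k0. \<exists>(i::int) (j::int) (l::int). (i, j) \<noteq> (0::int, 0::int) \<and>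
        \<bar>ternary a b c d e f i j (l + (i * fst \<theta> + j * snd \<theta>)) - \<xi>\<bar> < 1 / 2 ^ Suc k \<and>
        \<bar>i\<bar> < (2 powr \<kappa>) ^ k \<and> \<bar>j\<bar> < (2 powr \<kappa>) ^ k \<and> \<bar>l\<bar> < (2 powr \<kappa>) ^ k"
proof -
  interpret T: prob_space torus by (rule prob_space_torus)
  define R where "R k = (2 powr \<kappa>) ^ k" for k :: nat
  let ?S = "\<lambda>(\<theta> :: real \<times> real) (\<epsilon> :: real) (B :: real). \<exists>(i::int) (j::int) (l::int). (i, j) \<noteq> (0::int, 0::int) \<and>
        \<bar>ternary a b c d e f i j (l + (i * fst \<theta> + j * snd \<theta>)) - \<xi>\<bar> < \<epsilon> \<and>
        \<bar>i\<bar> \<le> B \<and> \<bar>j\<bar> \<le> B \<and> \<bar>l\<bar> \<le> B"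
  obtain K :: real where K: "K \<ge> 1" and ex: "\<And>(N::nat) (\<epsilon>::real). K \<le> real N \<Longrightarrow> 0 < \<epsilon> \<Longrightarrow> \<epsilon> \<le> 1 \<Longrightarrow>
    \<exists>E\<in>sets torus. measure torus E \<le> K / (real N * \<epsilon>) \<and> (\<forall>\<theta>\<in>{0..<1} \<times> {0..<1} - E. ?S \<theta> \<epsilon> (K * N))"
    using torus_exceptional_set[OF neg pos mn, of \<xi>] by blast
  \<comment> \<open>The divisor \<open>2 * K\<close> makes the coordinate bound
    \<open>K * N k\<close> strictly smaller than \<open>R k\<close>.\<close>
  define N where "N k = nat \<lfloor>R k / (2 * K)\<rfloor>" for k
  have "2 powr 1 < 2 powr \<kappa>" using \<kappa> by (intro powr_less_mono) auto
  then have two: "2 < 2 powr \<kappa>" by simp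
  have "R k \<ge> 2 ^ k" for k unfolding R_def using two by (intro power_mono) auto
  moreover have "filterlim (\<lambda>k. 2 ^ k :: real) at_top sequentially" by real_asymp
  ultimately have "filterlim R at_top sequentially"
    by (auto elim!: filterlim_at_top_mono intro: always_eventually)
  \<comment> \<open>From here on \<open>R k / (2 * K)\<close> is at least K + 1, so its floor is at
    least K and at least half of it.\<close>
  then have "eventually (\<lambda>k. R k \<ge> 2 * K * (K + 1)) sequentially"
    by (simp add: filterlim_at_top)
  then obtain k0 where k0: "\<And>k. k \<ge> k0 \<Longrightarrow> R k \<ge> 2 * K * (K + 1)"
    by (auto simp: eventually_sequentially)
  have N: "K \<le> N k" "R k / (4 * K) \<le> N k" if "k \<ge> k0" for k
  proof -
    have "K + 1 \<le> R k / (2 * K)" using k0[OF that] K by (simp add: field_simps)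
    moreover have "R k / (4 * K) = (R k / (2 * K)) / 2" by simp
    moreover have "real (N k) \<ge> R k / (2 * K) - 1" unfolding N_def by linarith
    ultimately show "K \<le> N k" "R k / (4 * K) \<le> N k" using K by linarith+
  qed
  have Rpos: "R k > 0" for k by (simp add: R_def)
  have KN: "K * N k < R k" for k
  proof -
    have "real (N k) \<le> R k / (2 * K)"
      using Rpos[of k] K by (simp add: N_def)
    then have "K * N k \<le> K * (R k / (2 * K))" using K by (intro mult_left_mono) auto
    also have "\<dots> = R k / 2" using K by simp
    also have "\<dots> < R k" using Rpos[of k] by simp
    finally show ?thesis .
  qed
  have "\<forall>k. \<exists>E. k \<ge> k0 \<longrightarrow> E \<in> sets torus \<and> measure torus E \<le> K / (N k * (1 / 2 ^ Suc k)) \<and>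
      (\<forall>\<theta>\<in>{0..<1} \<times> {0..<1} - E. ?S \<theta> (1 / 2 ^ Suc k) (K * N k))"
  proof
    fix k
    have "(1::real) \<le> 2 ^ Suc k" by (rule one_le_power) simp
    then have "0 < 1 / (2::real) ^ Suc k" "1 / (2::real) ^ Suc k \<le> 1"
      by (simp_all del: power_Suc)
    then show "\<exists>E. k \<ge> k0 \<longrightarrow> E \<in> sets torus \<and> measure torus E \<le> K / (N k * (1 / 2 ^ Suc k)) \<and>
      (\<forall>\<theta>\<in>{0..<1} \<times> {0..<1} - E. ?S \<theta> (1 / 2 ^ Suc k) (K * N k))"
      using ex[OF N(1), of k "1 / 2 ^ Suc k"] by blast
  qed
  then obtain E where E: "\<And>k. k \<ge> k0 \<Longrightarrow> E k \<in> sets torus"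
    "\<And>k. k \<ge> k0 \<Longrightarrow> measure torus (E k) \<le> K / (N k * (1 / 2 ^ Suc k))"
    "\<And>k \<theta>. k \<ge> k0 \<Longrightarrow> \<theta> \<in> {0..<1} \<times> {0..<1} - E k \<Longrightarrow> ?S \<theta> (1 / 2 ^ Suc k) (K * N k)"
    by metis
  define q where "q = 2 / 2 powr \<kappa>"
  have q: "0 \<le> q" "q < 1" using two by (simp_all add: q_def)
  have bound: "measure torus (E k) \<le> 8 * K\<^sup>2 * q ^ k" if "k \<ge> k0" for k
  proof -
    have "measure torus (E k) \<le> K / (N k * (1 / 2 ^ Suc k))" by (rule E(2)[OF that])
    also have "\<dots> \<le> K / (R k / (4 * K) * (1 / 2 ^ Suc k))"
      using N(2)[OF that] N(1)[OF that] K Rpos[of k]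
      by (intro divide_left_mono mult_right_mono mult_pos_pos divide_pos_pos) auto
    also have "\<dots> = 8 * K\<^sup>2 * (2 ^ k / R k)"
      using K Rpos[of k] by (simp add: field_simps power2_eq_square)
    also have "2 ^ k / R k = q ^ k" by (simp add: q_def R_def power_divide)
    finally show ?thesis .
  qed
  have "summable (\<lambda>k. 8 * K\<^sup>2 * q ^ (k + k0))"
    using q by (intro summable_mult summable_ignore_initial_segment summable_geometric) auto
  then have "summable (\<lambda>k. measure torus (E (k + k0)))"
    by (rule summable_comparison_test'[where N = 0]) (use bound in auto)
  then have "AE \<theta> in torus. eventually (\<lambda>k. \<theta> \<in> space torus - E (k + k0)) sequentially"
    using E(1) by (intro borel_cantelli_AE1) (auto simp: T.emeasure_eq_measure)
  with AE_torus show ?thesis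
  proof eventually_elim
    case (elim \<theta>)
    then obtain k1 where k1: "\<And>k. k \<ge> k1 \<Longrightarrow> \<theta> \<notin> E (k + k0)"
      by (auto simp: eventually_sequentially)
    show ?case
    proof (intro exI[of _ "k1 + k0"] allI impI)
      fix k assume k: "k1 + k0 \<le> k"
      then have "\<theta> \<notin> E k" using k1[of "k - k0"] by simp
      then have "?S \<theta> (1 / 2 ^ Suc k) (K * N k)" using E(3)[of k \<theta>] k elim by simp
      then show "\<exists>(i::int) (j::int) (l::int). (i, j) \<noteq> (0::int, 0::int) \<and>
        \<bar>ternary a b c d e f i j (l + (i * fst \<theta> + j * snd \<theta>)) - \<xi>\<bar> < 1 / 2 ^ Suc k \<and>
        \<bar>i\<bar> < (2 powr \<kappa>) ^ k \<and> \<bar>j\<bar> < (2 powr \<kappa>) ^ k \<and> \<bar>l\<bar> < (2 powr \<kappa>) ^ k"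
        using KN[of k] unfolding R_def by (meson le_less_trans)
    qed
  qed
qed

section \<open>Averaging Haar measure over shears\<close>

lemma continuous_on_det:
  fixes F :: "'a::topological_space \<Rightarrow> real^'n^'n"
  assumes "\<And>i j. continuous_on S (\<lambda>x. F x $ i $ j)"
  shows "continuous_on S (\<lambda>x. det (F x))"
  unfolding det_def by (intro continuous_on_sum continuous_on_mult continuous_on_const continuous_on_prod assms)

lemma closed_SL: "closed (SL :: (real^'n^'n) set)"
  unfolding SL_def
  by (intro closed_Collect_eq continuous_on_det continuous_on_component continuous_on_id continuous_on_const)

lemma haar_measure_SL_space:
  assumes "haar_measure_SL \<mu>"
  shows "space \<mu> = SL"
  using assms sets_eq_imp_space_eq[of \<mu> "restrict_space borel SL"]
  by (simp add: haar_measure_SL_def space_restrict_space)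

text \<open>Prepares Fubini's theorem. As \<open>SL\<close> is closed, its intersections with closed
  balls are compact and hence of finite measure.\<close>

lemma haar_measure_SL_sigma_finite:
  fixes \<mu> :: "(real^'n^'n) measure"
  assumes haar: "haar_measure_SL \<mu>"
  shows "sigma_finite_measure \<mu>"
proof
  let ?A = "range (\<lambda>n::nat. SL \<inter> cball 0 (real n)) :: (real^'n^'n) set set"
  have "emeasure \<mu> a \<noteq> \<infinity>" if a: "a \<in> ?A" for a
  proof -
    have "compact a \<and> a \<subseteq> SL" using a closed_SL by (auto intro: closed_Int_compact)
    then have "emeasure \<mu> a < \<infinity>" using haar unfolding haar_measure_SL_def by blast
    then show ?thesis by simp
  qed
  moreover have "?A \<subseteq> sets \<mu>"
  proof
    fix a assume "a \<in> ?A"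
    then obtain n :: nat where "a = SL \<inter> cball 0 (real n)" by blast
    moreover have "cball 0 (real n) \<in> sets (borel :: (real^'n^'n) measure)" by simp
    ultimately show "a \<in> sets \<mu>"
      using haar unfolding haar_measure_SL_def sets_restrict_space by blast
  qed
  moreover have "\<Union> ?A = space \<mu>"
  proof -
    have "g \<in> \<Union> ?A" if "g \<in> SL" for g :: "real^'n^'n"
      using that real_arch_simple[of "norm g"] by auto
    then show ?thesis unfolding haar_measure_SL_space[OF haar] by blast
  qed
  moreover have "countable ?A" by simp
  ultimately show "\<exists>A. countable A \<and> A \<subseteq> sets \<mu> \<and> \<Union> A = space \<mu> \<and> (\<forall>a\<in>A. emeasure \<mu> a \<noteq> \<infinity>)"
    by metis
qed

text \<open>A commutative unipotent subgroup: the first two coordinates stay fixed, and the third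
  moves by the linear form \<theta> in them. The inverse is
  \<open>shear (- \<theta>)\<close>.\<close>

definition shear :: "real \<times> real \<Rightarrow> real^3^3" where
  "shear \<theta> = vector [vector [1, 0, 0], vector [0, 1, 0], vector [fst \<theta>, snd \<theta>, 1]]"

lemma det_shear: "det (shear \<theta>) = 1"
  by (simp add: det_3 shear_def)

lemma shear_uminus_mult: "shear \<theta> ** shear (- \<theta>) = mat 1"
  by (simp add: vec_eq_iff forall_3 matrix_matrix_mult_def sum_3 shear_def mat_def)

lemma shear_mult_vector: "shear \<theta> *v vector [p, q, z] = vector [p, q, z + (p * fst \<theta> + q * snd \<theta>)]"
  by (simp add: vec_eq_iff forall_3 matrix_vector_mult_def sum_3 shear_def mult.commute)

lemma matrix_inv:
  fixes A :: "real^'n^'n"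
  assumes "invertible A"
  shows matrix_inv_right: "A ** matrix_inv A = mat 1"
    and matrix_inv_left: "matrix_inv A ** A = mat 1"
proof -
  have "A ** matrix_inv A = mat 1 \<and> matrix_inv A ** A = mat 1"
    unfolding matrix_inv_def by (rule someI_ex) (use assms in \<open>simp add: invertible_def\<close>)
  then show "A ** matrix_inv A = mat 1" "matrix_inv A ** A = mat 1" by auto
qed

lemma matrix_inv_unique:
  fixes A B :: "real^'n^'n"
  assumes "A ** B = mat 1"
  shows "matrix_inv A = B"
proof -
  have "B ** A = mat 1" using assms matrix_left_right_inverse by blast
  then have "invertible A" using assms unfolding invertible_def by blast
  then have "matrix_inv A ** A = mat 1" by (rule matrix_inv_left)
  then have "matrix_inv A ** (A ** B) = B" by (simp add: matrix_mul_assoc)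
  then show ?thesis by (simp add: assms)
qed

lemma invertible_SL: "g \<in> SL \<Longrightarrow> invertible (g :: real^'n^'n)"
  by (simp add: SL_def invertible_det_nz)

text \<open>Translating g by \<open>shear (- \<theta>)\<close> on the left composes the form
  belonging to g with \<open>shear \<theta>\<close>; this links the group to the torus
  estimates.\<close>

lemma matrix_inv_shear_mult:
  assumes "g \<in> SL"
  shows "matrix_inv (shear (- \<theta>) ** g) = matrix_inv g ** shear \<theta>"
proof (rule matrix_inv_unique)
  have "(shear (- \<theta>) ** g) ** (matrix_inv g ** shear \<theta>) = shear (- \<theta>) ** (g ** matrix_inv g) ** shear \<theta>"
    by (simp add: matrix_mul_assoc)
  also have "\<dots> = mat 1"
    using shear_uminus_mult[of "- \<theta>"] matrix_inv_right[OF invertible_SL[OF assms]] by simp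
  finally show "(shear (- \<theta>) ** g) ** (matrix_inv g ** shear \<theta>) = mat 1" .
qed

text \<open>Integrating over the shears avoids a decomposition of Haar measure itself.\<close>

lemma haar_null_of_shear_null:
  fixes \<mu> :: "(real^3^3) measure"
  assumes haar: "haar_measure_SL \<mu>" and B: "B \<in> sets \<mu>"
    and null: "\<And>g. g \<in> SL \<Longrightarrow> AE \<theta> in torus. shear (- \<theta>) ** g \<notin> B"
  shows "emeasure \<mu> B = 0"
proof -
  interpret M: sigma_finite_measure \<mu> by (rule haar_measure_SL_sigma_finite[OF haar])
  interpret T: prob_space torus by (rule prob_space_torus)
  interpret MT: pair_sigma_finite \<mu> torus ..
  have sets: "sets \<mu> = sets (restrict_space borel SL)" using haar by (simp add: haar_measure_SL_def)
  have space: "space \<mu> = SL" by (rule haar_measure_SL_space[OF haar])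
  have setsT: "sets torus = sets (borel :: (real \<times> real) measure)"
    unfolding borel_prod[symmetric] by (intro sets_pair_measure_cong) auto
  define F where "F p = shear (- snd p) ** fst p" for p :: "(real^3^3) \<times> (real \<times> real)"
  have "continuous_on UNIV (\<lambda>p :: (real^3^3) \<times> (real \<times> real). shear (- snd p) $ i $ k)" for i k
    using exhaust_3[of i] exhaust_3[of k]
    by (elim disjE) (simp_all add: shear_def continuous_on_fst continuous_on_snd continuous_on_minus)
  moreover have "continuous_on UNIV (\<lambda>p :: (real^3^3) \<times> (real \<times> real). fst p $ k $ j)" for k j
    by (intro continuous_intros)
  ultimately have "continuous_on UNIV F"
    unfolding F_def matrix_matrix_mult_def sum_3
    by (intro continuous_on_vec_lambda continuous_on_add continuous_on_mult)
  then have "F \<in> borel_measurable borel" by (rule borel_measurable_continuous_onI)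
  \<comment> \<open>The \<sigma>-algebra of \<mu> is a trace of the Borel one, so pairs map
    measurably into the Borel space on which F is continuous.\<close>
  moreover have "(\<lambda>p. p) \<in> (\<mu> \<Otimes>\<^sub>M torus) \<rightarrow>\<^sub>M (borel :: ((real^3^3) \<times> (real \<times> real)) measure)"
  proof -
    have "fst \<in> (\<mu> \<Otimes>\<^sub>M torus) \<rightarrow>\<^sub>M (borel :: (real^3^3) measure)"
      using measurable_fst[of \<mu> torus] measurable_restrict_space2_iff[of fst "\<mu> \<Otimes>\<^sub>M torus" borel SL]
        measurable_cong_sets[OF refl sets] by blast
    moreover have "snd \<in> (\<mu> \<Otimes>\<^sub>M torus) \<rightarrow>\<^sub>M (borel :: (real \<times> real) measure)"
      using measurable_snd[of \<mu> torus] measurable_cong_sets[OF refl setsT] by blast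
    ultimately have "(\<lambda>p. (fst p, snd p)) \<in> (\<mu> \<Otimes>\<^sub>M torus) \<rightarrow>\<^sub>M (borel :: ((real^3^3) \<times> (real \<times> real)) measure)"
      by (rule borel_measurable_Pair)
    then show ?thesis by simp
  qed
  ultimately have "F \<in> (\<mu> \<Otimes>\<^sub>M torus) \<rightarrow>\<^sub>M borel" by (rule measurable_compose[rotated])
  moreover have "F \<in> space (\<mu> \<Otimes>\<^sub>M torus) \<rightarrow> SL"
    by (auto simp: F_def space_pair_measure space SL_def det_mul det_shear)
  ultimately have F: "F \<in> (\<mu> \<Otimes>\<^sub>M torus) \<rightarrow>\<^sub>M \<mu>"
    using measurable_restrict_space2[of F "\<mu> \<Otimes>\<^sub>M torus" SL borel] measurable_cong_sets[OF refl sets] by blast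
  define C where "C = F -` B \<inter> space (\<mu> \<Otimes>\<^sub>M torus)"
  have C: "C \<in> sets (\<mu> \<Otimes>\<^sub>M torus)" unfolding C_def by (rule measurable_sets[OF F B])
  have "emeasure \<mu> B = (\<integral>\<^sup>+ \<theta>. emeasure \<mu> B \<partial>torus)"
    using T.emeasure_space_1 by simp
  also have "\<dots> = (\<integral>\<^sup>+ \<theta>. emeasure \<mu> ((\<lambda>g. (g, \<theta>)) -` C) \<partial>torus)"
  proof (rule nn_integral_cong)
    fix \<theta> :: "real \<times> real"
    \<comment> \<open>The slice of C at any \<theta> is a left translate of B, hence of the same
      measure by invariance.\<close>
    have "(\<lambda>g. (g, \<theta>)) -` C = (\<lambda>g. shear \<theta> ** g) ` B"
    proof (intro set_eqI iffI)
      fix g assume "g \<in> (\<lambda>g. (g, \<theta>)) -` C"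
      then have "shear (- \<theta>) ** g \<in> B" by (simp add: C_def F_def)
      moreover have "g = shear \<theta> ** (shear (- \<theta>) ** g)"
        by (simp add: matrix_mul_assoc shear_uminus_mult)
      ultimately show "g \<in> (\<lambda>g. shear \<theta> ** g) ` B" by blast
    next
      fix g assume "g \<in> (\<lambda>g. shear \<theta> ** g) ` B"
      then obtain b where b: "b \<in> B" "g = shear \<theta> ** b" by blast
      moreover have "b \<in> SL" using b B sets.sets_into_space space by blast
      moreover have "shear (- \<theta>) ** (shear \<theta> ** b) = b"
        using shear_uminus_mult[of "- \<theta>"] by (simp add: matrix_mul_assoc)
      ultimately show "g \<in> (\<lambda>g. (g, \<theta>)) -` C"
        by (simp add: C_def F_def space_pair_measure space SL_def det_mul det_shear)
    qed
    moreover have "shear \<theta> \<in> SL" by (simp add: SL_def det_shear)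
    ultimately show "emeasure \<mu> B = emeasure \<mu> ((\<lambda>g. (g, \<theta>)) -` C)"
      using haar B unfolding haar_measure_SL_def by simp
  qed
  also have "\<dots> = emeasure (\<mu> \<Otimes>\<^sub>M torus) C"
    by (rule MT.emeasure_pair_measure_alt2[OF C, symmetric])
  \<comment> \<open>Slicing the other way: for fixed g the slice consists of the \<theta> whose
    shear carries g into B, which is null by assumption.\<close>
  also have "\<dots> = (\<integral>\<^sup>+ g. emeasure torus (Pair g -` C) \<partial>\<mu>)"
    by (rule T.emeasure_pair_measure_alt[OF C])
  also have "\<dots> = (\<integral>\<^sup>+ g. 0 \<partial>\<mu>)"
  proof (rule nn_integral_cong)
    fix g assume g: "g \<in> space \<mu>"
    have "AE \<theta> in torus. \<theta> \<notin> Pair g -` C"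
      using null[of g] g space by (auto simp: C_def F_def elim: eventually_mono)
    moreover have "Pair g -` C \<in> sets torus" using C by (rule sets_Pair1)
    ultimately show "emeasure torus (Pair g -` C) = 0"
      by (simp add: AE_iff_measurable[OF _ refl] space_torus AE_iff_null_sets null_setsD1)
  qed
  finally show ?thesis by simp
qed

section \<open>Quadratic forms in coordinates and the dyadic condition\<close>

lemma quadratic_form_inner: "quadratic_form A x = x \<bullet> (A *v x)"
  by (simp add: quadratic_form_def inner_vec_def matrix_vector_mult_def sum_distrib_left mult_ac)

lemma quadratic_form_compose: "quadratic_form A (B *v x) = quadratic_form (transpose B ** A ** B) x"
proof -
  have "(B *v x) \<bullet> (A *v (B *v x)) = x \<bullet> (transpose B *v (A *v (B *v x)))"
    by (metis dot_lmul_matrix vector_transpose_matrix transpose_transpose)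
  then show ?thesis
    by (simp add: quadratic_form_inner matrix_vector_mul_assoc matrix_mul_assoc)
qed

lemma quadratic_form_3:
  fixes C :: "real^3^3"
  assumes "transpose C = C"
  shows "quadratic_form C x =
    ternary (C $ 1 $ 1) (C $ 2 $ 2) (C $ 3 $ 3) (C $ 1 $ 2) (C $ 1 $ 3) (C $ 2 $ 3) (x $ 1) (x $ 2) (x $ 3)"
proof -
  have "transpose C $ j $ i = C $ i $ j" for i j by (simp add: transpose_def)
  then have "C $ i $ j = C $ j $ i" for i j by (simp add: assms)
  then have "C $ 2 $ 1 = C $ 1 $ 2" "C $ 3 $ 1 = C $ 1 $ 3" "C $ 3 $ 2 = C $ 2 $ 3" by auto
  then show ?thesis
    by (simp add: quadratic_form_def sum_3 ternary_def power2_eq_square algebra_simps)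
qed

text \<open>Scale k pairs the accuracy 2^-(k+1) with the box of radius 2^(\<kappa> k). With this
  shift by one, a solution at scale k serves every \<epsilon> in [2^-(k+1), 2^-k). All quantifiers
  are countable, which makes the condition measurable.\<close>

definition dyadic_solvable :: "real \<Rightarrow> real \<Rightarrow> (real^3 \<Rightarrow> real) \<Rightarrow> bool" where
  "dyadic_solvable \<xi> \<kappa> Q \<longleftrightarrow>
    (\<exists>k0::nat. \<forall>k\<ge>k0. \<exists>(i::int) (j::int) (l::int). (i, j) \<noteq> (0::int, 0::int) \<and>
      \<bar>Q (vector [real_of_int i, real_of_int j, real_of_int l]) - \<xi>\<bar> < 1 / 2 ^ Suc k \<and>
      \<bar>i\<bar> < (2 powr \<kappa>) ^ k \<and> \<bar>j\<bar> < (2 powr \<kappa>) ^ k \<and> \<bar>l\<bar> < (2 powr \<kappa>) ^ k)"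

lemma AE_dyadic_solvable_shear:
  fixes C :: "real^3^3"
  assumes sym: "transpose C = C" and det: "det C \<noteq> 0" and "\<kappa> > 1"
    and neg: "quadratic_form C v < 0" and pos: "quadratic_form C w > 0"
  shows "AE \<theta> in torus. dyadic_solvable \<xi> \<kappa> (\<lambda>x. quadratic_form C (shear \<theta> *v x))"
proof -
  have "transpose C $ j $ 3 = C $ 3 $ j" for j by (simp add: transpose_def)
  then have "C $ 3 $ j = C $ j $ 3" for j by (simp add: sym)
  then have C: "C $ 3 $ 1 = C $ 1 $ 3" "C $ 3 $ 2 = C $ 2 $ 3" by auto
  \<comment> \<open>Otherwise the third column vanishes, contradicting nondegeneracy.\<close>
  have nz: "C $ 3 $ 3 \<noteq> 0 \<or> C $ 1 $ 3 \<noteq> 0 \<or> C $ 2 $ 3 \<noteq> 0"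
  proof (rule ccontr)
    assume "\<not> ?thesis"
    then have "det C = 0" by (simp add: det_3 C)
    then show False using det by simp
  qed
  from ternary_indefinite_plane[OF neg[unfolded quadratic_form_3[OF sym]] pos[unfolded quadratic_form_3[OF sym]] nz]
  obtain m n :: int and z1 z2 where mn: "(m, n) \<noteq> (0, 0)" and
    z: "ternary (C $ 1 $ 1) (C $ 2 $ 2) (C $ 3 $ 3) (C $ 1 $ 2) (C $ 1 $ 3) (C $ 2 $ 3) m n z1 < 0"
      "ternary (C $ 1 $ 1) (C $ 2 $ 2) (C $ 3 $ 3) (C $ 1 $ 2) (C $ 1 $ 3) (C $ 2 $ 3) m n z2 > 0"
    by (elim exE conjE)
  show ?thesis
    using torus_AE_eventually[OF z mn \<open>\<kappa> > 1\<close>, of \<xi>]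
    unfolding dyadic_solvable_def shear_mult_vector quadratic_form_3[OF sym] by simp
qed

text \<open>In the diagonalising coordinates, a basis vector indexed by S has value 1 and one
  indexed by its complement has value -1; both index sets are nonempty.\<close>

lemma has_signature_2_1_indefinite:
  assumes "has_signature (Q :: real^3 \<Rightarrow> real) 2 1"
  shows "\<exists>v. Q v < 0" and "\<exists>w. Q w > 0"
proof -
  obtain S :: "3 set" and B :: "real^3^3" where S: "card S = 2" "card (- S) = 1" and
    Q: "\<And>x. Q (B *v x) = (\<Sum>i\<in>S. (x $ i)\<^sup>2) - (\<Sum>i\<in>- S. (x $ i)\<^sup>2)"
    using assms unfolding has_signature_def by blast
  have *: "(\<Sum>i\<in>T. ((axis k 1 :: real^3) $ i)\<^sup>2) = (if k \<in> T then 1 else 0)" for T :: "3 set" and k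
    by (simp add: axis_def if_distrib[of "\<lambda>x. x ^ 2"] sum.delta cong: if_cong)
  obtain i where "i \<in> S" using S by fastforce
  then have "Q (B *v axis i 1) = 1" by (simp add: Q *)
  then show "\<exists>w. Q w > 0" by (metis zero_less_one)
  have "- S \<noteq> {}" using S(2) by (metis card.empty zero_neq_one)
  then obtain j where "j \<in> - S" by blast
  then have "Q (B *v axis j 1) = - 1" by (simp add: Q *)
  then show "\<exists>v. Q v < 0" by (metis neg_less_0_iff_less zero_less_one)
qed

text \<open>On \<open>SL\<close> the inverse depends continuously on g, and the condition combines
  countably many measurable inequalities.\<close>

lemma sets_not_dyadic_solvable:
  fixes \<mu> :: "(real^3^3) measure"
  assumes haar: "haar_measure_SL \<mu>"
  shows "{g \<in> SL. \<not> dyadic_solvable \<xi> \<kappa> (\<lambda>x. quadratic_form A (matrix_inv g *v x))} \<in> sets \<mu>"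
proof -
  have sets: "sets \<mu> = sets (restrict_space borel SL)" using haar by (simp add: haar_measure_SL_def)
  have space: "space \<mu> = SL" by (rule haar_measure_SL_space[OF haar])
  have [measurable]: "(\<lambda>g. quadratic_form A (matrix_inv g *v x)) \<in> borel_measurable \<mu>" for x
  proof -
    \<comment> \<open>The numerators of Cramer's rule: polynomial in g, and equal to
      \<open>matrix_inv g *v x\<close> on \<open>SL\<close>, where the denominator is 1.\<close>
    define y :: "real^3^3 \<Rightarrow> real^3" where "y g = (\<chi> k. det (\<chi> i j. if j = k then x $ i else g $ i $ j))" for g
    have y: "continuous_on UNIV (\<lambda>g. y g $ k)" for k
      unfolding y_def vec_lambda_beta
    proof (rule continuous_on_det)
      fix i j
      show "continuous_on UNIV (\<lambda>g :: real^3^3. (\<chi> i j. if j = k then x $ i else g $ i $ j) $ i $ j)"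
        by (cases "j = k") (auto intro!: continuous_intros)
    qed
    have "continuous_on UNIV (\<lambda>g. quadratic_form A (y g))"
      unfolding quadratic_form_def by (intro continuous_on_sum continuous_on_mult continuous_on_const y)
    then have "(\<lambda>g. quadratic_form A (y g)) \<in> borel_measurable borel"
      by (rule borel_measurable_continuous_onI)
    then have "(\<lambda>g. quadratic_form A (y g)) \<in> borel_measurable \<mu>"
      using measurable_restrict_space1 measurable_cong_sets[OF sets refl] by blast
    moreover have "quadratic_form A (matrix_inv g *v x) = quadratic_form A (y g)" if "g \<in> space \<mu>" for g
    proof -
      have g: "det g = 1" "invertible g" using that space by (auto simp: SL_def invertible_det_nz)
      have "g *v (matrix_inv g *v x) = x"
        by (simp add: matrix_vector_mul_assoc matrix_inv_right[OF g(2)])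
      then have "matrix_inv g *v x = y g"
        using cramer[of g "matrix_inv g *v x" x] g by (simp add: y_def)
      then show ?thesis by simp
    qed
    ultimately show ?thesis by (subst measurable_cong) auto
  qed
  have "{g \<in> space \<mu>. \<not> dyadic_solvable \<xi> \<kappa> (\<lambda>x. quadratic_form A (matrix_inv g *v x))} \<in> sets \<mu>"
    unfolding dyadic_solvable_def by measurable
  then show ?thesis by (simp add: space)
qed

text \<open>For each fixed g the form belonging to g is again nondegenerate and indefinite, so
  almost every shear of it is solvable; \<open>haar_null_of_shear_null\<close> turns this into a
  null set of g.\<close>

lemma AE_haar_dyadic_solvable:
  fixes A :: "real^3^3"
  assumes haar: "haar_measure_SL \<mu>" and sym: "transpose A = A" and det: "det A \<noteq> 0"
    and sgn: "has_signature (quadratic_form A) 2 1" and \<kappa>: "\<kappa> > 1"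
  shows "AE g in \<mu>. dyadic_solvable \<xi> \<kappa> (\<lambda>x. quadratic_form A (matrix_inv g *v x))"
proof -
  define B where "B = {g \<in> SL. \<not> dyadic_solvable \<xi> \<kappa> (\<lambda>x. quadratic_form A (matrix_inv g *v x))}"
  have B: "B \<in> sets \<mu>" unfolding B_def by (rule sets_not_dyadic_solvable[OF haar])
  obtain v w where v: "quadratic_form A v < 0" and w: "quadratic_form A w > 0"
    using has_signature_2_1_indefinite[OF sgn] by blast
  have "emeasure \<mu> B = 0"
  proof (rule haar_null_of_shear_null[OF haar B])
    fix g :: "real^3^3" assume g: "g \<in> SL"
    \<comment> \<open>The symmetric matrix of the form belonging to g. Its negative and positive
      values are found at \<open>g *v v\<close> and \<open>g *v w\<close>.\<close>
    define C where "C = transpose (matrix_inv g) ** A ** matrix_inv g"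
    have gC: "quadratic_form C y = quadratic_form A (matrix_inv g *v y)" for y
      by (simp add: C_def quadratic_form_compose)
    have inv: "matrix_inv g ** g = mat 1" by (rule matrix_inv_left[OF invertible_SL[OF g]])
    then have "det (matrix_inv g) = 1"
      using g det_mul[of "matrix_inv g" g] by (simp add: SL_def)
    then have "det C \<noteq> 0" using det by (simp add: C_def det_mul)
    moreover have "transpose C = C"
      by (simp add: C_def matrix_transpose_mul sym matrix_mul_assoc)
    moreover have "quadratic_form C (g *v v) < 0" "quadratic_form C (g *v w) > 0"
      using v w by (simp_all add: gC matrix_vector_mul_assoc inv)
    ultimately have "AE \<theta> in torus. dyadic_solvable \<xi> \<kappa> (\<lambda>x. quadratic_form C (shear \<theta> *v x))"
      using \<kappa> by (intro AE_dyadic_solvable_shear)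
    then show "AE \<theta> in torus. shear (- \<theta>) ** g \<notin> B"
      by eventually_elim (simp add: B_def gC matrix_inv_shear_mult[OF g] matrix_vector_mul_assoc)
  qed
  then have "B \<in> null_sets \<mu>" using B by (simp add: null_sets_def)
  then show ?thesis
    by (rule AE_I') (auto simp: B_def haar_measure_SL_space[OF haar])
qed

section \<open>From dyadic scales to every small \<epsilon>\<close>

lemma infnorm_vector_3_less:
  fixes p q z :: real
  assumes "\<bar>p\<bar> < r" "\<bar>q\<bar> < r" "\<bar>z\<bar> < r"
  shows "infnorm (vector [p, q, z] :: real^3) < r"
proof -
  have "{\<bar>(vector [p, q, z] :: real^3) $ i\<bar> |i. i \<in> UNIV} = {\<bar>p\<bar>, \<bar>q\<bar>, \<bar>z\<bar>}"
    unfolding Setcompr_eq_image UNIV_3 by simp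
  then have "infnorm (vector [p, q, z] :: real^3) = Max {\<bar>p\<bar>, \<bar>q\<bar>, \<bar>z\<bar>}"
    unfolding infnorm_cart by (simp add: cSup_eq_Max)
  then show ?thesis using assms by simp
qed

text \<open>The least k satisfying the lower bound works: minimality gives the upper bound for k >
  0, and for k = 0 it follows from \<epsilon> < 1.\<close>

lemma dyadic_bracket:
  fixes \<epsilon> :: real
  assumes "0 < \<epsilon>" "\<epsilon> < 1 / 2 ^ k0"
  obtains k where "k \<ge> k0" "1 / 2 ^ Suc k \<le> \<epsilon>" "\<epsilon> < 1 / 2 ^ k"
proof -
  obtain n where n: "(1 / 2) ^ n < \<epsilon>"
    using real_arch_pow_inv[of \<epsilon> "1 / 2"] assms by auto
  define k where "k = (LEAST k. 1 / 2 ^ Suc k \<le> \<epsilon>)"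
  have "1 / 2 ^ Suc n \<le> \<epsilon>" using n assms by (simp add: power_divide field_simps)
  then have le: "1 / 2 ^ Suc k \<le> \<epsilon>" unfolding k_def by (rule LeastI)
  have "k \<ge> k0"
  proof (rule ccontr)
    assume "\<not> k \<ge> k0"
    then have "(2::real) ^ Suc k \<le> 2 ^ k0" by (intro power_increasing) auto
    then have "1 / (2::real) ^ k0 \<le> 1 / 2 ^ Suc k" by (intro divide_left_mono) auto
    then show False using le assms by linarith
  qed
  moreover have "\<epsilon> < 1 / 2 ^ k"
  proof (cases k)
    case 0
    have "1 / (2::real) ^ k0 \<le> 1" by simp
    then have "\<epsilon> < 1" using assms(2) by linarith
    then show ?thesis by (simp add: 0)
  next
    case (Suc k')
    then have "\<not> 1 / 2 ^ Suc k' \<le> \<epsilon>" using not_less_Least[of k' "\<lambda>k. 1 / 2 ^ Suc k \<le> \<epsilon>"] unfolding k_def by simp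
    then show ?thesis using Suc by simp
  qed
  ultimately show ?thesis using le that by blast
qed

text \<open>At the scale k that brackets \<epsilon> the accuracy is at most \<epsilon>, and since
  \<epsilon> < 2^-k the box radius \<open>(1 / 2 ^ k) powr (- \<kappa>)\<close> is at most
  \<open>\<epsilon> powr (- \<kappa>)\<close>.\<close>

lemma dyadic_solvable_imp:
  assumes "dyadic_solvable \<xi> \<kappa> Q" and \<kappa>: "\<kappa> > 1"
  shows "\<exists>\<epsilon>0>0. \<forall>\<epsilon>. 0 < \<epsilon> \<and> \<epsilon> < \<epsilon>0 \<longrightarrow>
      (\<exists>x. (\<forall>i. x $ i \<in> \<int>) \<and> x \<noteq> 0 \<and> \<bar>Q x - \<xi>\<bar> < \<epsilon> \<and> infnorm x < \<epsilon> powr (- \<kappa>))"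
proof -
  obtain k0 :: nat where k0: "\<And>k. k \<ge> k0 \<Longrightarrow> \<exists>(i::int) (j::int) (l::int). (i, j) \<noteq> (0::int, 0::int) \<and>
      \<bar>Q (vector [real_of_int i, real_of_int j, real_of_int l]) - \<xi>\<bar> < 1 / 2 ^ Suc k \<and>
      \<bar>i\<bar> < (2 powr \<kappa>) ^ k \<and> \<bar>j\<bar> < (2 powr \<kappa>) ^ k \<and> \<bar>l\<bar> < (2 powr \<kappa>) ^ k"
    using assms unfolding dyadic_solvable_def by blast
  have "\<exists>x. (\<forall>i. x $ i \<in> \<int>) \<and> x \<noteq> 0 \<and> \<bar>Q x - \<xi>\<bar> < \<epsilon> \<and> infnorm x < \<epsilon> powr (- \<kappa>)"
    if \<epsilon>: "0 < \<epsilon>" "\<epsilon> < 1 / 2 ^ k0" for \<epsilon> :: real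
  proof -
    obtain k where k: "k \<ge> k0" "1 / 2 ^ Suc k \<le> \<epsilon>" "\<epsilon> < 1 / 2 ^ k"
      using dyadic_bracket[OF \<epsilon>] .
    obtain i j l :: int where ijl: "(i, j) \<noteq> (0, 0)" "\<bar>Q (vector [real_of_int i, real_of_int j, real_of_int l]) - \<xi>\<bar> < 1 / 2 ^ Suc k"
      "\<bar>i\<bar> < (2 powr \<kappa>) ^ k" "\<bar>j\<bar> < (2 powr \<kappa>) ^ k" "\<bar>l\<bar> < (2 powr \<kappa>) ^ k"
      using k0[OF k(1)] by blast
    define x :: "real^3" where "x = vector [real_of_int i, real_of_int j, real_of_int l]"
    have "1 / 2 ^ k = 2 powr (- real k)"
      by (simp add: powr_minus powr_realpow divide_inverse)
    then have "(2 powr \<kappa>) ^ k = (1 / 2 ^ k) powr (- \<kappa>)"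
      by (simp add: powr_powr powr_realpow[symmetric] mult.commute)
    also have "\<dots> \<le> \<epsilon> powr (- \<kappa>)"
      using \<epsilon> k \<kappa> by (intro powr_mono2') auto
    finally have "(2 powr \<kappa>) ^ k \<le> \<epsilon> powr (- \<kappa>)" .
    moreover have "infnorm x < (2 powr \<kappa>) ^ k"
      unfolding x_def using ijl by (intro infnorm_vector_3_less) auto
    moreover have "x \<noteq> 0" using ijl by (auto simp: x_def vec_eq_iff forall_3)
    moreover have "\<forall>i. x $ i \<in> \<int>" by (simp add: x_def forall_3)
    moreover have "\<bar>Q x - \<xi>\<bar> < \<epsilon>" using ijl k by (simp add: x_def)
    ultimately show ?thesis by (intro exI[of _ x]) simp
  qed
  then show ?thesis by (intro exI[of _ "1 / 2 ^ k0"]) simp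
qed

theorem theorem1p2:
  fixes l \<xi> \<kappa> :: real
  assumes "l \<noteq> 0" and "\<kappa> > 1"
  shows "almost_all_forms 2 1 l (\<lambda>Q :: real^3 \<Rightarrow> real.
    \<exists>\<epsilon>0>0. \<forall>\<epsilon>. 0 < \<epsilon> \<and> \<epsilon> < \<epsilon>0 \<longrightarrow>
      (\<exists>x. (\<forall>i. x $ i \<in> \<int>) \<and> x \<noteq> 0 \<and>
        \<bar>Q x - \<xi>\<bar> < \<epsilon> \<and> infnorm x < \<epsilon> powr (- \<kappa>)))"
  unfolding almost_all_forms_def
proof (intro ballI allI impI)
  fix Q0 :: "real^3 \<Rightarrow> real" and \<mu> :: "(real^3^3) measure"
  assume "Q0 \<in> quadratic_forms 2 1 l" and haar: "haar_measure_SL \<mu>"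
  then obtain A where A: "Q0 = quadratic_form A" "transpose A = A" "det A = l"
    "has_signature (quadratic_form A) 2 1"
    by (auto simp: quadratic_forms_def)
  have "AE g in \<mu>. dyadic_solvable \<xi> \<kappa> (\<lambda>x. Q0 (matrix_inv g *v x))"
    unfolding A(1) using haar A assms by (intro AE_haar_dyadic_solvable) auto
  then show "AE g in \<mu>. \<exists>\<epsilon>0>0. \<forall>\<epsilon>. 0 < \<epsilon> \<and> \<epsilon> < \<epsilon>0 \<longrightarrow>
      (\<exists>x. (\<forall>i. x $ i \<in> \<int>) \<and> x \<noteq> 0 \<and>
        \<bar>Q0 (matrix_inv g *v x) - \<xi>\<bar> < \<epsilon> \<and> infnorm x < \<epsilon> powr (- \<kappa>))"
    by eventually_elim (rule dyadic_solvable_imp[OF _ assms(2)])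
qed

end
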